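(* Let $(M,g,\mathcal{E})$ be an ambient structure of a Riemannian manifold $M$ with metric operator $g$. At each $x\in M$, $g_x$ defines an inner product $\langle\omega_1,\omega_2\rangle_{g,x}=\langle\omega_1,g_x\omega_2\rangle_{\mathcal{E}}$ on $\mathcal{E}$; let $\Pi_{g,x}$ be the associated projection to $T_xM$. Then $\Pi_g:x\mapsto\Pi_{g,x}$ is a smooth map from $M$ to $L(\mathcal{E},\mathcal{E})$. There exists a smooth function $\Gamma$ from $M$ to $L(\mathcal{E}\otimes\mathcal{E},\mathcal{E})$ (the $\mathcal{E}$-valued bilinear forms on $\mathcal{E}$) such that for all vector fields $X,Y$ on $M$ and all $x\in M$, $$(\nabla_XY)_x=(D_XY)_x+\Gamma(X_x,Y_x)_x,$$ where $\nabla$ is the Levi-Civita connection of the metric induced by $g$. (Any such $\Gamma$ is called a Christoffel function of $(M,g,\mathcal{E})$.) For tangent vectors $\xi,\eta$ at $x$, $\Gamma(\xi,\eta)_x$ is independent of the vector field extensions of $\xi$ and $\eta$, and depends only on the restriction of the metric operator $g$ to the tangent bundle. If $\mathcal{X}$ is a smooth function from $M$ to the space of $\mathcal{E}$-valued bilinear forms on $\mathcal{E}$ such that for every $x\in M$ and all $\xi,\eta,\phi\in T_xM$, $$\langle\mathcal{X}(\xi,\eta)_x,\phi\rangle_{\mathcal{E}}=\langle(D_\phi g)_x\xi,\eta\rangle_{\mathcal{E}},$$ then for all $\xi,\eta\in T_xM$, $$\Gamma(\xi,\eta)_x=-(D_\xi\Pi_g)_x\eta+\tfrac12\Pi_{g,x}g_x^{-1}\big((D_\xi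 g)\eta+(D_\eta g)\xi-\mathcal{X}(\xi,\eta)\big)_x.$$
   Context: $\mathcal{E}$ is a finite-dimensional real inner product space. An (embedded) ambient structure $(M,g,\mathcal{E})$ consists of a Riemannian manifold $M$ differentiably embedded as a submanifold of $\mathcal{E}$ (the metric of $M$ need not be induced from $\mathcal{E}$), so that $T_xM\subset\mathcal{E}$, and a metric operator $g$: a smooth map $g:M\to L(\mathcal{E},\mathcal{E})$ such that each $g_x$ is (self-adjoint) positive-definite and $\langle\xi,g_x\eta\rangle_{\mathcal{E}}$ equals the Riemannian inner product of $\xi,\eta\in T_xM$. Vector fields are identified with $\mathcal{E}$-valued functions on $M$; $D$ denotes the directional derivative of vector- or operator-valued functions on $M$. The projection associated with $g_x$ is the one orthogonal for $\langle\cdot,\cdot\rangle_{g,x}$. *)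

theory Defs
  imports "HOL-Analysis.Analysis"
begin

text \<open>
  Both predicates are meant for open \<open>U\<close> and a finite-dimensional domain. There, continuity of all
  directional derivatives is the same as continuity of the Frechet derivative in operator norm.
\<close>

primrec Ck_on ::
  "nat \<Rightarrow> 'a::real_normed_vector set \<Rightarrow> ('a \<Rightarrow> 'b::real_normed_vector) \<Rightarrow> bool" where
  "Ck_on 0 U f \<longleftrightarrow> continuous_on U f"
| "Ck_on (Suc k) U f \<longleftrightarrow>
     (\<forall>x\<in>U. f differentiable (at x)) \<and>
     (\<forall>v. Ck_on k U (\<lambda>x. frechet_derivative f (at x) v))"

definition smooth_on ::
  "'a::real_normed_vector set \<Rightarrow> ('a \<Rightarrow> 'b::real_normed_vector) \<Rightarrow> bool" where
  "smooth_on U f \<longleftrightarrow> (\<forall>k. Ck_on k U f)"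

definition embedded_submanifold :: "nat \<Rightarrow> 'a::euclidean_space set \<Rightarrow> bool" where
  "embedded_submanifold d M \<longleftrightarrow>
     (\<forall>p\<in>M. \<exists>U (V :: 'a set) \<phi> \<psi> S.
        open U \<and> p \<in> U \<and> open V \<and>
        homeomorphism U V \<phi> \<psi> \<and> smooth_on U \<phi> \<and> smooth_on V \<psi> \<and>
        subspace S \<and> dim S = d \<and> \<phi> ` (M \<inter> U) = V \<inter> S)"

text \<open>
  Objects living on \<open>M\<close> (functions, vector fields, operator fields) are total functions on the
  ambient space; only their values at points of \<open>M\<close> matter.
\<close>

definition smooth_map ::
  "'a::euclidean_space set \<Rightarrow> ('a \<Rightarrow> 'b::real_normed_vector) \<Rightarrow> bool" where
  "smooth_map M f \<longleftrightarrow>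
     (\<forall>p\<in>M. \<exists>U F. open U \<and> p \<in> U \<and> smooth_on U F \<and> (\<forall>x\<in>M \<inter> U. F x = f x))"

definition curve_in ::
  "'a::euclidean_space set \<Rightarrow> 'a \<Rightarrow> 'a \<Rightarrow> (real \<Rightarrow> 'a) \<Rightarrow> bool" where
  "curve_in M x v \<gamma> \<longleftrightarrow>
     (\<exists>e>0. smooth_on {-e<..<e} \<gamma> \<and> (\<forall>t\<in>{-e<..<e}. \<gamma> t \<in> M)) \<and>
     \<gamma> 0 = x \<and> (\<gamma> has_vector_derivative v) (at 0)"

definition tangent_space :: "'a::euclidean_space set \<Rightarrow> 'a \<Rightarrow> 'a set" where
  "tangent_space M x = {v. \<exists>\<gamma>. curve_in M x v \<gamma>}"

text \<open>
  The directional derivative \<open>(D\<^sub>v f)\<^sub>x\<close> of a vector- or operator-valued function on \<open>M\<close>. It is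
  determined for smooth \<open>f\<close> and tangent \<open>v\<close>; elsewhere its value is irrelevant.
\<close>

definition dir_deriv ::
  "'a::euclidean_space set \<Rightarrow> ('a \<Rightarrow> 'b::real_normed_vector) \<Rightarrow> 'a \<Rightarrow> 'a \<Rightarrow> 'b" where
  "dir_deriv M f x v =
     (THE w. \<forall>\<gamma>. curve_in M x v \<gamma> \<longrightarrow> ((\<lambda>t. f (\<gamma> t)) has_vector_derivative w) (at 0))"

definition vector_field :: "'a::euclidean_space set \<Rightarrow> ('a \<Rightarrow> 'a) \<Rightarrow> bool" where
  "vector_field M X \<longleftrightarrow> smooth_map M X \<and> (\<forall>x\<in>M. X x \<in> tangent_space M x)"

definition riemannian_metric ::
  "'a::euclidean_space set \<Rightarrow> ('a \<Rightarrow> 'a \<Rightarrow> 'a \<Rightarrow> real) \<Rightarrow> bool" where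
  "riemannian_metric M \<rho> \<longleftrightarrow>
     (\<forall>x\<in>M. \<forall>u\<in>tangent_space M x. \<forall>v\<in>tangent_space M x.
        \<rho> x u v = \<rho> x v u \<and>
        (\<forall>w\<in>tangent_space M x. \<forall>a. \<rho> x (a *\<^sub>R u + v) w = a * \<rho> x u w + \<rho> x v w) \<and>
        (u \<noteq> 0 \<longrightarrow> 0 < \<rho> x u u)) \<and>
     (\<forall>X Y. vector_field M X \<and> vector_field M Y \<longrightarrow> smooth_map M (\<lambda>x. \<rho> x (X x) (Y x)))"

definition affine_connection ::
  "'a::euclidean_space set \<Rightarrow> (('a \<Rightarrow> 'a) \<Rightarrow> ('a \<Rightarrow> 'a) \<Rightarrow> 'a \<Rightarrow> 'a) \<Rightarrow> bool" where
  "affine_connection M nabla \<longleftrightarrow>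
     (\<forall>X Y. vector_field M X \<and> vector_field M Y \<longrightarrow> vector_field M (nabla X Y)) \<and>
     (\<forall>X X' Y. vector_field M X \<and> vector_field M X' \<and> vector_field M Y \<longrightarrow>
        (\<forall>x\<in>M. nabla (\<lambda>y. X y + X' y) Y x = nabla X Y x + nabla X' Y x)) \<and>
     (\<forall>f X Y. smooth_map M f \<and> vector_field M X \<and> vector_field M Y \<longrightarrow>
        (\<forall>x\<in>M. nabla (\<lambda>y. f y *\<^sub>R X y) Y x = f x *\<^sub>R nabla X Y x)) \<and>
     (\<forall>X Y Y'. vector_field M X \<and> vector_field M Y \<and> vector_field M Y' \<longrightarrow>
        (\<forall>x\<in>M. nabla X (\<lambda>y. Y y + Y' y) x = nabla X Y x + nabla X Y' x)) \<and>
     (\<forall>f X Y. smooth_map M f \<and> vector_field M X \<and> vector_field M Y \<longrightarrow>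
        (\<forall>x\<in>M. nabla X (\<lambda>y. f y *\<^sub>R Y y) x =
                 dir_deriv M f x (X x) *\<^sub>R Y x + f x *\<^sub>R nabla X Y x))"

text \<open>\<open>Z = [X, Y]\<close>, the Lie bracket being the commutator of derivations of smooth functions.\<close>

definition is_lie_bracket ::
  "'a::euclidean_space set \<Rightarrow> ('a \<Rightarrow> 'a) \<Rightarrow> ('a \<Rightarrow> 'a) \<Rightarrow> ('a \<Rightarrow> 'a) \<Rightarrow> bool" where
  "is_lie_bracket M X Y Z \<longleftrightarrow>
     vector_field M Z \<and>
     (\<forall>f :: 'a \<Rightarrow> real. smooth_map M f \<longrightarrow>
        (\<forall>x\<in>M. dir_deriv M f x (Z x) =
           dir_deriv M (\<lambda>y. dir_deriv M f y (Y y)) x (X x) -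
           dir_deriv M (\<lambda>y. dir_deriv M f y (X y)) x (Y x)))"

definition torsion_free ::
  "'a::euclidean_space set \<Rightarrow> (('a \<Rightarrow> 'a) \<Rightarrow> ('a \<Rightarrow> 'a) \<Rightarrow> 'a \<Rightarrow> 'a) \<Rightarrow> bool" where
  "torsion_free M nabla \<longleftrightarrow>
     (\<forall>X Y. vector_field M X \<and> vector_field M Y \<longrightarrow>
        is_lie_bracket M X Y (\<lambda>x. nabla X Y x - nabla Y X x))"

definition metric_compatible ::
  "'a::euclidean_space set \<Rightarrow> ('a \<Rightarrow> 'a \<Rightarrow> 'a \<Rightarrow> real) \<Rightarrow>
     (('a \<Rightarrow> 'a) \<Rightarrow> ('a \<Rightarrow> 'a) \<Rightarrow> 'a \<Rightarrow> 'a) \<Rightarrow> bool" where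
  "metric_compatible M \<rho> nabla \<longleftrightarrow>
     (\<forall>X Y Z. vector_field M X \<and> vector_field M Y \<and> vector_field M Z \<longrightarrow>
        (\<forall>x\<in>M. dir_deriv M (\<lambda>y. \<rho> y (Y y) (Z y)) x (X x) =
                 \<rho> x (nabla X Y x) (Z x) + \<rho> x (Y x) (nabla X Z x)))"

definition levi_civita ::
  "'a::euclidean_space set \<Rightarrow> ('a \<Rightarrow> 'a \<Rightarrow> 'a \<Rightarrow> real) \<Rightarrow>
     (('a \<Rightarrow> 'a) \<Rightarrow> ('a \<Rightarrow> 'a) \<Rightarrow> 'a \<Rightarrow> 'a) \<Rightarrow> bool" where
  "levi_civita M \<rho> nabla \<longleftrightarrow>
     affine_connection M nabla \<and> torsion_free M nabla \<and> metric_compatible M \<rho> nabla"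

definition metric_operator ::
  "'a::euclidean_space set \<Rightarrow> ('a \<Rightarrow> 'a \<Rightarrow> 'a \<Rightarrow> real) \<Rightarrow> ('a \<Rightarrow> 'a \<Rightarrow>\<^sub>L 'a) \<Rightarrow> bool" where
  "metric_operator M \<rho> g \<longleftrightarrow>
     smooth_map M g \<and>
     (\<forall>x\<in>M.
        (\<forall>u v. g x u \<bullet> v = u \<bullet> g x v) \<and>
        (\<forall>u. u \<noteq> 0 \<longrightarrow> 0 < u \<bullet> g x u) \<and>
        (\<forall>\<xi>\<in>tangent_space M x. \<forall>\<eta>\<in>tangent_space M x. \<xi> \<bullet> g x \<eta> = \<rho> x \<xi> \<eta>))"

definition ambient_structure ::
  "nat \<Rightarrow> 'a::euclidean_space set \<Rightarrow> ('a \<Rightarrow> 'a \<Rightarrow> 'a \<Rightarrow> real) \<Rightarrow> ('a \<Rightarrow> 'a \<Rightarrow>\<^sub>L 'a) \<Rightarrow> bool" where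
  "ambient_structure d M \<rho> g \<longleftrightarrow>
     embedded_submanifold d M \<and> riemannian_metric M \<rho> \<and> metric_operator M \<rho> g"

definition inner_g :: "('a::euclidean_space \<Rightarrow> 'a \<Rightarrow>\<^sub>L 'a) \<Rightarrow> 'a \<Rightarrow> 'a \<Rightarrow> 'a \<Rightarrow> real" where
  "inner_g g x \<omega>\<^sub>1 \<omega>\<^sub>2 = \<omega>\<^sub>1 \<bullet> g x \<omega>\<^sub>2"

definition proj_g ::
  "'a::euclidean_space set \<Rightarrow> ('a \<Rightarrow> 'a \<Rightarrow>\<^sub>L 'a) \<Rightarrow> 'a \<Rightarrow> 'a \<Rightarrow>\<^sub>L 'a" where
  "proj_g M g x =
     (THE P :: 'a \<Rightarrow>\<^sub>L 'a.
        \<forall>\<omega>. P \<omega> \<in> tangent_space M x \<and>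
            (\<forall>\<xi>\<in>tangent_space M x. inner_g g x \<xi> (\<omega> - P \<omega>) = 0))"

text \<open>Bilinear maps \<open>E \<times> E \<rightarrow> E\<close>, i.e. linear maps on the tensor square, are taken in curried form.\<close>

definition christoffel_function ::
  "'a::euclidean_space set \<Rightarrow> (('a \<Rightarrow> 'a) \<Rightarrow> ('a \<Rightarrow> 'a) \<Rightarrow> 'a \<Rightarrow> 'a) \<Rightarrow>
     ('a \<Rightarrow> 'a \<Rightarrow>\<^sub>L 'a \<Rightarrow>\<^sub>L 'a) \<Rightarrow> bool" where
  "christoffel_function M nabla \<Gamma> \<longleftrightarrow>
     smooth_map M \<Gamma> \<and>
     (\<forall>X Y. vector_field M X \<and> vector_field M Y \<longrightarrow>
        (\<forall>x\<in>M. nabla X Y x = dir_deriv M Y x (X x) + \<Gamma> x (X x) (Y x)))"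

end

theory Submission
  imports Defs
begin

text \<open>
  The proof works in the ambient space instead of charts. Near each of its points, a submanifold is
  the fixed point set of a smooth retraction \<open>r\<close> of an open set, and at a point of the submanifold the
  derivative of \<open>r\<close> is an idempotent whose range is the tangent space. This gives at once that tangent spaces are linear
  (\<open>subspace_tangent_space\<close>) and that the \<open>g\<close>-orthogonal projection \<open>\<Pi>\<close> is smooth: it is an explicit
  expression in \<open>g\<close>, the derivative of \<open>r\<close>, an adjoint and the inverse of a positive definite
  operator (\<open>smooth_orthogonal_projection\<close>), and inversion of operators is smooth. Conversely \<open>\<Pi>\<close>
  turns every constant vector \<open>w\<close> into a global vector field \<open>y \<mapsto> \<Pi>\<^sub>y w\<close>, so that tangent vectors have
  global extensions (\<open>vector_field_proj\<close>).

  Let \<open>A(X, Y) = \<nabla>\<^sub>X Y - D\<^sub>X Y\<close>, called the defect below. Everything follows from determining \<open>A(X, Y)\<^sub>x\<close>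
  in terms of \<open>X\<^sub>x\<close> and \<open>Y\<^sub>x\<close>. Vanishing torsion, tested on the linear coordinates of the ambient space,
  says that \<open>A\<close> is symmetric. Compatibility with the metric becomes
  \<open>\<langle>A(X, Y), g Z\<rangle> + \<langle>A(X, Z), g Y\<rangle> = \<langle>(D\<^sub>X g) Z, Y\<rangle>\<close>, since the derivatives of \<open>Y\<close> and \<open>Z\<close> cancel. As in the
  derivation of the Koszul formula, these two facts give
  \<open>2 \<langle>A(X, Y), g \<phi>\<rangle> = \<langle>(D\<^sub>X g) Y, \<phi>\<rangle> + \<langle>(D\<^sub>Y g) X, \<phi>\<rangle> - \<langle>(D\<^sub>\<phi> g) X, Y\<rangle>\<close> for tangent \<open>\<phi>\<close>
  (\<open>defect_tangential\<close>), which is the tangential part \<open>\<Pi> A\<close>. The normal part is \<open>- (D\<^sub>X \<Pi>) Y\<close>, by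
  differentiating \<open>\<Pi> Y = Y\<close> (\<open>defect_normal\<close>). Adding the two parts yields the formula of the theorem
  (\<open>defect_formula\<close>), whose right hand side is bilinear in \<open>X\<^sub>x\<close> and \<open>Y\<^sub>x\<close>. A Christoffel function
  is therefore obtained from the defects of the projected basis vectors
  (\<open>christoffel_function_exists\<close>), and the dependence on \<open>g\<close> can be read off from the tangential part
  (\<open>christoffel_function_unique_on_tangent\<close>).
\<close>

section \<open>Calculus of functions of class \<open>C\<^sup>k\<close>\<close>

text \<open>\<^const>\<open>Ck_on\<close> speaks of \<^const>\<open>frechet_derivative\<close>, whereas derivatives are computed as formulas
  that agree with it on \<open>U\<close>. Exchanging the two takes congruence at the level \<open>k\<close> below, a premise here
  because congruence is itself proved by induction with this rule; \<open>Ck_onI\<close> is free of it.\<close>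

lemma Ck_on_SucI:
  fixes f :: "'a::real_normed_vector \<Rightarrow> 'b::real_normed_vector"
  assumes "open U"
    and "\<And>x. x \<in> U \<Longrightarrow> (f has_derivative f' x) (at x)"
    and "\<And>v. Ck_on k U (\<lambda>x. f' x v)"
    and cong: "\<And>f h :: 'a \<Rightarrow> 'b.
      (\<And>x. x \<in> U \<Longrightarrow> f x = h x) \<Longrightarrow> Ck_on k U f \<Longrightarrow> Ck_on k U h"
  shows "Ck_on (Suc k) U f"
proof -
  have "f' x = frechet_derivative f (at x)" if "x \<in> U" for x
    using assms(2)[OF that] by (rule frechet_derivative_at)
  then have "Ck_on k U (\<lambda>x. frechet_derivative f (at x) v)" for v
    by (intro cong[OF _ assms(3)[of v]]) simp
  then show ?thesis
    using assms(2) by (auto simp: differentiable_def)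
qed

lemma Ck_on_cong:
  fixes f h :: "'a::real_normed_vector \<Rightarrow> 'b::real_normed_vector"
  assumes "open U" and "\<And>x. x \<in> U \<Longrightarrow> f x = h x" and "Ck_on k U f"
  shows "Ck_on k U h"
  using assms(2,3)
proof (induction k arbitrary: f h)
  case 0
  then show ?case
    using continuous_on_cong[of U U f h] by simp
next
  case (Suc k)
  show ?case
  proof (rule Ck_on_SucI[OF \<open>open U\<close>, where f' = "\<lambda>x. frechet_derivative f (at x)"])
    show "(h has_derivative frechet_derivative f (at x)) (at x)" if "x \<in> U" for x
      using Suc.prems that
      by (intro has_derivative_transform_within_open[of f _ _ _ U h] \<open>open U\<close>)
        (auto simp: frechet_derivative_works[symmetric])
    show "Ck_on k U (\<lambda>x. frechet_derivative f (at x) v)" for v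
      using Suc.prems(2) by simp
  qed (rule Suc.IH)
qed

lemmas Ck_onI = Ck_on_SucI[OF _ _ _ Ck_on_cong]

lemma Ck_on_has_derivative:
  assumes "Ck_on (Suc k) U f" "x \<in> U"
  shows "(f has_derivative frechet_derivative f (at x)) (at x)"
  using assms by (simp add: frechet_derivative_works)

lemma Ck_on_Suc_imp: "Ck_on (Suc k) U f \<Longrightarrow> Ck_on k U f"
proof (induction k arbitrary: f)
  case 0
  then show ?case
    by (auto intro!: continuous_at_imp_continuous_on differentiable_imp_continuous_within)
qed simp

lemma Ck_on_subset: "Ck_on k U f \<Longrightarrow> V \<subseteq> U \<Longrightarrow> Ck_on k V f"
  by (induction k arbitrary: f) (auto intro: continuous_on_subset)

lemma Ck_on_const [simp]: "open U \<Longrightarrow> Ck_on k U (\<lambda>x. c)"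
proof (induction k arbitrary: c)
  case (Suc k)
  then show ?case
    by (intro Ck_onI[where f' = "\<lambda>x v. 0"]) auto
qed simp

lemma Ck_on_bounded_linear:
  assumes "open U" "bounded_linear L"
  shows "Ck_on k U L"
proof (cases k)
  case 0
  then show ?thesis
    using assms by (simp add: linear_continuous_on)
next
  case (Suc j)
  show ?thesis
    unfolding Suc using assms
    by (intro Ck_onI[where f' = "\<lambda>x. L"]) (auto intro: bounded_linear_imp_has_derivative)
qed

lemma Ck_on_add:
  assumes "open U" "Ck_on k U f" "Ck_on k U h"
  shows "Ck_on k U (\<lambda>x. f x + h x)"
  using assms(2,3)
proof (induction k arbitrary: f h)
  case (Suc k)
  show ?case
    by (rule Ck_onI[where
          f' = "\<lambda>x v. frechet_derivative f (at x) v + frechet_derivative h (at x) v"])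
      (use Suc assms(1) in \<open>auto intro!: has_derivative_add Ck_on_has_derivative\<close>)
qed (auto intro: continuous_on_add)

lemma Ck_on_sum:
  assumes "open U" "\<And>i. i \<in> I \<Longrightarrow> Ck_on k U (f i)"
  shows "Ck_on k U (\<lambda>x. \<Sum>i\<in>I. f i x)"
  using assms(2)
  by (induction I rule: infinite_finite_induct) (auto intro!: Ck_on_add simp: assms(1))

lemma Ck_on_bilinear:
  assumes "open U" "bounded_bilinear bil" "Ck_on k U f" "Ck_on k U h"
  shows "Ck_on k U (\<lambda>x. bil (f x) (h x))"
  using assms(3,4)
proof (induction k arbitrary: f h)
  case 0
  then show ?case
    using bounded_bilinear.continuous_on[OF assms(2)] by auto
next
  case (Suc k)
  let ?f' = "\<lambda>x. frechet_derivative f (at x)" and ?h' = "\<lambda>x. frechet_derivative h (at x)"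
  show ?case
  proof (rule Ck_onI[OF assms(1), where f' = "\<lambda>x v. bil (f x) (?h' x v) + bil (?f' x v) (h x)"])
    show "((\<lambda>x. bil (f x) (h x)) has_derivative (\<lambda>v. bil (f x) (?h' x v) + bil (?f' x v) (h x))) (at x)"
      if "x \<in> U" for x
      using Suc.prems that by (intro bounded_bilinear.FDERIV[OF assms(2)] Ck_on_has_derivative)
    show "Ck_on k U (\<lambda>x. bil (f x) (?h' x v) + bil (?f' x v) (h x))" for v
      using Suc.prems Suc.prems[THEN Ck_on_Suc_imp] by (intro Ck_on_add Suc.IH assms(1)) auto
  qed (use assms(1) in auto)
qed

lemma Ck_on_linear_image:
  assumes "open U" "bounded_linear L" "Ck_on k U f"
  shows "Ck_on k U (\<lambda>x. L (f x))"
  using assms(3)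
proof (induction k arbitrary: f)
  case 0
  then show ?case
    using bounded_linear.continuous_on[OF assms(2)] by auto
next
  case (Suc k)
  show ?case
    by (rule Ck_onI[where f' = "\<lambda>x v. L (frechet_derivative f (at x) v)"])
      (use Suc assms(1) in
        \<open>auto intro!: bounded_linear.has_derivative[OF assms(2)] Ck_on_has_derivative\<close>)
qed

text \<open>
  Only derivatives in fixed directions enter \<^const>\<open>Ck_on\<close>, whereas the chain rule differentiates
  the outer function in the moving direction given by the derivative of the inner one; expanding
  that direction in an orthonormal basis reduces it to fixed directions.
\<close>

lemma Ck_on_compose:
  fixes f :: "'a::real_normed_vector \<Rightarrow> 'b::euclidean_space"
    and h :: "'b \<Rightarrow> 'c::real_normed_vector"
  assumes "open U" "open V" "f ` U \<subseteq> V" "Ck_on k U f" "Ck_on k V h"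
  shows "Ck_on k U (\<lambda>x. h (f x))"
  using assms(4,5)
proof (induction k arbitrary: h)
  case 0
  then show ?case
    using assms(3) continuous_on_compose2[of V h U f] by auto
next
  case (Suc k)
  let ?f' = "\<lambda>x. frechet_derivative f (at x)" and ?h' = "\<lambda>y. frechet_derivative h (at y)"
  have expand: "?h' (f x) (?f' x v) = (\<Sum>b\<in>Basis. (?f' x v \<bullet> b) *\<^sub>R ?h' (f x) b)"
    if "x \<in> U" for x v
  proof -
    have "linear (?h' (f x))"
      using Suc.prems assms(3) that by (intro linear_frechet_derivative) auto
    then have "?h' (f x) (\<Sum>b\<in>Basis. (?f' x v \<bullet> b) *\<^sub>R b)
        = (\<Sum>b\<in>Basis. (?f' x v \<bullet> b) *\<^sub>R ?h' (f x) b)"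
      by (simp add: linear_sum linear_scale)
    then show ?thesis
      by (simp add: euclidean_representation)
  qed
  have Ck: "Ck_on k U (\<lambda>x. \<Sum>b\<in>Basis. (?f' x v \<bullet> b) *\<^sub>R ?h' (f x) b)" for v
    using Suc.prems
    by (intro Ck_on_sum Ck_on_bilinear[OF _ bounded_bilinear_scaleR] assms(1) Suc.IH
        Ck_on_linear_image[OF _ bounded_linear_inner_left] Ck_on_Suc_imp[of k U f]) auto
  show ?case
  proof (rule Ck_onI[where f' = "\<lambda>x v. ?h' (f x) (?f' x v)", OF assms(1)])
    show "((\<lambda>x. h (f x)) has_derivative (\<lambda>v. ?h' (f x) (?f' x v))) (at x)" if "x \<in> U" for x
      using Suc.prems that assms(3)
      by (intro has_derivative_compose[of f _ _ _ h]) (auto intro!: Ck_on_has_derivative)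
    show "Ck_on k U (\<lambda>x. ?h' (f x) (?f' x v))" for v
      by (rule Ck_on_cong[OF assms(1) _ Ck]) (simp add: expand)
  qed (use assms(1) in auto)
qed

text \<open>Each summand is a bounded linear function of one value \<open>f b\<close>, which carries smoothness over
  from the values on the basis to the operator.\<close>

definition basis_blinfun ::
  "('a::euclidean_space \<Rightarrow> 'b::real_normed_vector) \<Rightarrow> 'a \<Rightarrow>\<^sub>L 'b" where
  "basis_blinfun f = (\<Sum>b\<in>Basis. blinfun_scaleR_left (f b) o\<^sub>L blinfun_inner_right b)"

lemma basis_blinfun_apply: "basis_blinfun f v = (\<Sum>b\<in>Basis. (v \<bullet> b) *\<^sub>R f b)"
  by (simp add: basis_blinfun_def blinfun.sum_left blinfun_inner_right.rep_eq inner_commute)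

lemma basis_blinfun_linear: "linear f \<Longrightarrow> basis_blinfun f v = f v"
  using linear_sum[of f "\<lambda>b. (v \<bullet> b) *\<^sub>R b" Basis]
  by (simp add: basis_blinfun_apply linear_scale euclidean_representation)

lemma bounded_linear_basis_summand:
  "bounded_linear (\<lambda>w. blinfun_scaleR_left w o\<^sub>L blinfun_inner_right b)"
  by (rule bounded_linear_compose[OF
        bounded_bilinear.bounded_linear_left[OF bounded_bilinear_blinfun_compose]
        bounded_linear_blinfun_scaleR_left])

section \<open>Inversion of operators\<close>

text \<open>Meaningful for injective, hence bijective, operators.\<close>

definition blinfun_inv :: "('a::euclidean_space \<Rightarrow>\<^sub>L 'a) \<Rightarrow> 'a \<Rightarrow>\<^sub>L 'a" where
  "blinfun_inv A = Blinfun (inv (blinfun_apply A))"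

lemma blinfun_linear: "linear (blinfun_apply A)"
  by (simp add: blinfun.bounded_linear_right bounded_linear.linear)

lemma inj_blinfun_surj:
  fixes A :: "'a::euclidean_space \<Rightarrow>\<^sub>L 'a"
  shows "inj (blinfun_apply A) \<Longrightarrow> surj (blinfun_apply A)"
  by (simp add: blinfun_linear linear_injective_imp_surjective)

lemma blinfun_inv_apply:
  fixes A :: "'a::euclidean_space \<Rightarrow>\<^sub>L 'a"
  assumes "inj (blinfun_apply A)"
  shows "blinfun_apply (blinfun_inv A) = inv (blinfun_apply A)"
proof -
  have "linear (inv (blinfun_apply A))"
    by (simp add: assms blinfun_linear inj_blinfun_surj inj_linear_imp_inv_linear)
  then show ?thesis
    unfolding blinfun_inv_def by (intro bounded_linear_Blinfun_apply) (simp add: linear_linear)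
qed

lemma blinfun_inv_left: "inj (blinfun_apply A) \<Longrightarrow> blinfun_inv A (A v) = v"
  by (simp add: blinfun_inv_apply)

lemma blinfun_inv_right: "inj (blinfun_apply A) \<Longrightarrow> A (blinfun_inv A v) = v"
  by (simp add: blinfun_inv_apply inj_blinfun_surj surj_f_inv_f)

lemma norm_blinfun_compose3: "norm (A o\<^sub>L B o\<^sub>L C) \<le> norm A * norm B * norm C"
  by (rule order_trans[OF norm_blinfun_compose mult_right_mono[OF norm_blinfun_compose norm_ge_zero]])

context
  fixes A :: "'a::euclidean_space \<Rightarrow>\<^sub>L 'a"
  assumes inj: "inj (blinfun_apply A)"
begin

text \<open>With \<open>c = \<parallel>A\<inverse>\<parallel>\<close> one has \<open>\<parallel>A u\<parallel> \<ge> \<parallel>u\<parallel> / c\<close>, and a perturbation of size less than \<open>1 / (2 c)\<close>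
  costs at most half of this bound.\<close>

lemma perturbed_lower_bound:
  assumes "norm (B - A) * (2 * norm (blinfun_inv A)) \<le> 1"
  shows "norm u \<le> 2 * norm (blinfun_inv A) * norm (B u)"
proof -
  let ?c = "norm (blinfun_inv A)"
  have "norm u = norm (blinfun_inv A (A u))"
    by (simp add: blinfun_inv_left inj)
  also have "\<dots> \<le> ?c * norm (A u)"
    by (rule norm_blinfun)
  also have "norm (A u) \<le> norm (B u) + norm ((B - A) u)"
    by (simp add: blinfun.diff_left) (metis norm_triangle_sub norm_minus_commute add.commute)
  also have "norm ((B - A) u) \<le> norm (B - A) * norm u"
    by (rule norm_blinfun)
  finally have "norm u \<le> ?c * (norm (B u) + norm (B - A) * norm u)"
    by (simp add: mult_left_mono)
  also have "\<dots> = ?c * norm (B u) + (norm (B - A) * (2 * ?c)) * norm u / 2"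
    by (simp add: algebra_simps)
  also have "\<dots> \<le> ?c * norm (B u) + norm u / 2"
    using mult_right_mono[OF assms, of "norm u"] by simp
  finally show ?thesis
    by simp
qed

lemma eventually_perturbation_small:
  "\<forall>\<^sub>F B in at A. norm (B - A) * (2 * norm (blinfun_inv A)) \<le> 1"
proof -
  have "((\<lambda>B. norm (B - A) * (2 * norm (blinfun_inv A))) \<longlongrightarrow> norm (A - A) * (2 * norm (blinfun_inv A)))
      (at A)"
    by (intro tendsto_intros)
  then have "\<forall>\<^sub>F B in at A. norm (B - A) * (2 * norm (blinfun_inv A)) < 1"
    by (rule order_tendstoD) simp
  then show ?thesis
    by (rule eventually_mono) simp
qed

lemma perturbed_inj:
  assumes "norm (B - A) * (2 * norm (blinfun_inv A)) \<le> 1"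
  shows "inj (blinfun_apply B)"
proof -
  have "u = 0" if "B u = 0" for u
    using perturbed_lower_bound[OF assms, of u] that by simp
  then show ?thesis
    by (simp add: linear_injective_0[OF blinfun_linear])
qed

lemma isCont_blinfun_inv: "isCont blinfun_inv A"
proof -
  let ?c = "norm (blinfun_inv A)"
  have "norm (blinfun_inv B - blinfun_inv A) \<le> 2 * ?c * norm (B - A) * ?c"
    if small: "norm (B - A) * (2 * ?c) \<le> 1" for B
  proof -
    note injB = perturbed_inj[OF small]
    have inv_le: "norm (blinfun_inv B) \<le> 2 * ?c"
    proof (rule norm_blinfun_bound)
      show "norm (blinfun_inv B u) \<le> 2 * ?c * norm u" for u
        using perturbed_lower_bound[OF small, of "blinfun_inv B u"]
        by (simp only: blinfun_inv_right[OF injB])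
    qed simp
    have "blinfun_inv B - blinfun_inv A = blinfun_inv B o\<^sub>L (A - B) o\<^sub>L blinfun_inv A"
      by (rule blinfun_eqI)
        (simp only: blinfun.diff_left blinfun.diff_right blinfun_inv_left[OF injB]
          blinfun_inv_right[OF inj] blinfun_apply_blinfun_compose)
    then have "norm (blinfun_inv B - blinfun_inv A) \<le> norm (blinfun_inv B) * norm (B - A) * ?c"
      using norm_blinfun_compose3[of "blinfun_inv B" "A - B" "blinfun_inv A"]
      by (simp add: norm_minus_commute)
    moreover have "norm (blinfun_inv B) * norm (B - A) * ?c \<le> 2 * ?c * norm (B - A) * ?c"
      by (intro mult_right_mono inv_le) auto
    ultimately show ?thesis
      by simp
  qed
  then have "\<forall>\<^sub>F B in at A. norm (blinfun_inv B - blinfun_inv A) \<le> 2 * ?c * norm (B - A) * ?c"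
    using eventually_perturbation_small by (rule eventually_mono[rotated])
  moreover have "((\<lambda>B. 2 * ?c * norm (B - A) * ?c) \<longlongrightarrow> 2 * ?c * norm (A - A) * ?c) (at A)"
    by (intro tendsto_intros)
  ultimately have "((\<lambda>B. blinfun_inv B - blinfun_inv A) \<longlongrightarrow> 0) (at A)"
    by (rule Lim_null_comparison[OF _ tendsto_eq_rhs]) simp
  then show ?thesis
    by (simp add: isCont_def LIM_zero_iff)
qed

end

text \<open>The resolvent identity \<open>B\<inverse> - A\<inverse> = - B\<inverse> (B - A) A\<inverse>\<close> differs from the claimed derivative
  by \<open>(A\<inverse> - B\<inverse>) (B - A) A\<inverse>\<close>, which is of smaller order by continuity of inversion.\<close>

lemma has_derivative_blinfun_inv:
  fixes A :: "'a::euclidean_space \<Rightarrow>\<^sub>L 'a"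
  assumes inj: "inj (blinfun_apply A)"
  shows "(blinfun_inv has_derivative (\<lambda>H. - (blinfun_inv A o\<^sub>L H o\<^sub>L blinfun_inv A))) (at A)"
proof -
  let ?I = "blinfun_inv A"
  let ?R = "\<lambda>B. norm (blinfun_inv B - ?I - - (?I o\<^sub>L (B - A) o\<^sub>L ?I)) / norm (B - A)"
  have lin: "bounded_linear (\<lambda>H. - (?I o\<^sub>L H o\<^sub>L ?I))"
    by (intro bounded_linear_minus bounded_linear_compose[OF
          bounded_bilinear.bounded_linear_left[OF bounded_bilinear_blinfun_compose]
          bounded_bilinear.bounded_linear_right[OF bounded_bilinear_blinfun_compose]])
  have "?R B \<le> norm (?I - blinfun_inv B) * norm ?I"
    if small: "norm (B - A) * (2 * norm ?I) \<le> 1" for B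
  proof -
    note injB = perturbed_inj[OF inj small]
    have "blinfun_inv B - ?I - - (?I o\<^sub>L (B - A) o\<^sub>L ?I)
        = (?I - blinfun_inv B) o\<^sub>L (B - A) o\<^sub>L ?I"
      by (rule blinfun_eqI)
        (simp add: blinfun.diff_left blinfun.diff_right blinfun.minus_left blinfun.add_left blinfun_inv_left[OF injB]
          blinfun_inv_left[OF inj] blinfun_inv_right[OF inj])
    then have "norm (blinfun_inv B - ?I - - (?I o\<^sub>L (B - A) o\<^sub>L ?I))
        \<le> norm (?I - blinfun_inv B) * norm (B - A) * norm ?I"
      by (simp only: norm_blinfun_compose3)
    then show ?thesis
      by (cases "B = A") (auto simp: divide_simps mult_ac)
  qed
  then have "\<forall>\<^sub>F B in at A. ?R B \<le> norm (?I - blinfun_inv B) * norm ?I"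
    using eventually_perturbation_small[OF inj] by (rule eventually_mono[rotated])
  moreover have "((\<lambda>B. norm (?I - blinfun_inv B) * norm ?I) \<longlongrightarrow> norm (?I - ?I) * norm ?I) (at A)"
    using isCont_blinfun_inv[OF inj] by (intro tendsto_intros) (simp add: isCont_def)
  ultimately have "(?R \<longlongrightarrow> 0) (at A)"
    by (intro Lim_null_comparison[of ?R, OF _ tendsto_eq_rhs]) simp_all
  with lin show ?thesis
    by (simp add: has_derivative_iff_norm)
qed

lemma Ck_on_blinfun_inv:
  fixes F :: "'a::real_normed_vector \<Rightarrow> 'b::euclidean_space \<Rightarrow>\<^sub>L 'b"
  assumes "open U" "\<And>x. x \<in> U \<Longrightarrow> inj (blinfun_apply (F x))" "Ck_on k U F"
  shows "Ck_on k U (\<lambda>x. blinfun_inv (F x))"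
  using assms(3)
proof (induction k)
  case 0
  then have "isCont F x" if "x \<in> U" for x
    using that by (simp add: continuous_on_eq_continuous_at[OF assms(1)])
  then have "isCont (\<lambda>x. blinfun_inv (F x)) x" if "x \<in> U" for x
    using that isCont_o2[of x F blinfun_inv] isCont_blinfun_inv[of "F x"] assms(2) by blast
  then show ?case
    by (simp add: continuous_at_imp_continuous_on)
next
  case (Suc k)
  let ?G = "\<lambda>x. blinfun_inv (F x)" and ?F' = "\<lambda>x. frechet_derivative F (at x)"
  have Ck: "Ck_on k U ?G"
    using Suc.prems by (intro Suc.IH) (rule Ck_on_Suc_imp)
  show ?case
  proof (rule Ck_onI[where f' = "\<lambda>x v. - (?G x o\<^sub>L ?F' x v o\<^sub>L ?G x)", OF assms(1)])
    show "(?G has_derivative (\<lambda>v. - (?G x o\<^sub>L ?F' x v o\<^sub>L ?G x))) (at x)" if "x \<in> U" for x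
      using has_derivative_compose[OF Ck_on_has_derivative[OF Suc.prems that]
          has_derivative_blinfun_inv[OF assms(2)[OF that]]] .
    show "Ck_on k U (\<lambda>x. - (?G x o\<^sub>L ?F' x v o\<^sub>L ?G x))" for v
      using Suc.prems
      by (intro Ck_on_linear_image[OF assms(1) bounded_linear_minus[OF bounded_linear_ident]]
          Ck_on_bilinear[OF assms(1) bounded_bilinear_blinfun_compose] Ck) simp
  qed (use assms(1) in auto)
qed

section \<open>Smooth maps on a subset of Euclidean space\<close>

lemma smooth_on_subset: "smooth_on U f \<Longrightarrow> V \<subseteq> U \<Longrightarrow> smooth_on V f"
  unfolding smooth_on_def by (blast intro: Ck_on_subset)

lemma smooth_on_has_derivative:
  assumes "smooth_on U f" "x \<in> U"
  shows "(f has_derivative frechet_derivative f (at x)) (at x)"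
  using assms Ck_on_has_derivative[of 0 U f x] unfolding smooth_on_def by blast

lemma smooth_on_frechet_derivative:
  "smooth_on U f \<Longrightarrow> smooth_on U (\<lambda>x. frechet_derivative f (at x) v)"
  unfolding smooth_on_def using Ck_on.simps(2) by blast

lemma smooth_mapE:
  assumes "smooth_map M f" "p \<in> M"
  obtains U F where "open U" "p \<in> U" "smooth_on U F" "\<And>x. x \<in> M \<inter> U \<Longrightarrow> F x = f x"
proof -
  obtain U F where "open U \<and> p \<in> U \<and> smooth_on U F \<and> (\<forall>x\<in>M \<inter> U. F x = f x)"
    using bspec[OF assms(1)[unfolded smooth_map_def] assms(2)] by (elim exE)
  then show ?thesis
    by (intro that[of U F]) auto
qed

lemma smooth_mapI:
  assumes "\<And>p. p \<in> M \<Longrightarrow> \<exists>U F. open U \<and> p \<in> U \<and> smooth_on U F \<and> (\<forall>x\<in>M \<inter> U. F x = f x)"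
  shows "smooth_map M f"
  unfolding smooth_map_def by (intro ballI assms)

lemma smooth_on_imp_smooth_map: "open U \<Longrightarrow> smooth_on U f \<Longrightarrow> smooth_map (M \<inter> U) f"
  by (rule smooth_mapI) auto

lemma smooth_map_subset:
  assumes "smooth_map M f" "N \<subseteq> M"
  shows "smooth_map N f"
proof (rule smooth_mapI)
  fix p assume "p \<in> N"
  with assms(2) have "p \<in> M"
    by blast
  with assms(1) obtain U F where "open U" "p \<in> U" "smooth_on U F" "\<And>x. x \<in> M \<inter> U \<Longrightarrow> F x = f x"
    by (rule smooth_mapE) blast
  with assms(2) show "\<exists>U F. open U \<and> p \<in> U \<and> smooth_on U F \<and> (\<forall>x\<in>N \<inter> U. F x = f x)"
    by (intro exI[of _ U] exI[of _ F]) auto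
qed

lemma smooth_map_cong:
  assumes "smooth_map M f" "\<And>x. x \<in> M \<Longrightarrow> f x = h x"
  shows "smooth_map M h"
proof (rule smooth_mapI)
  fix p assume "p \<in> M"
  with assms(1) obtain U F where "open U" "p \<in> U" "smooth_on U F" "\<And>x. x \<in> M \<inter> U \<Longrightarrow> F x = f x"
    by (rule smooth_mapE) blast
  with assms(2) show "\<exists>U F. open U \<and> p \<in> U \<and> smooth_on U F \<and> (\<forall>x\<in>M \<inter> U. F x = h x)"
    by (intro exI[of _ U] exI[of _ F]) auto
qed

lemma smooth_map_local:
  assumes "\<And>p. p \<in> M \<Longrightarrow> \<exists>U. open U \<and> p \<in> U \<and> smooth_map (M \<inter> U) f"
  shows "smooth_map M f"
proof (rule smooth_mapI)
  fix p assume "p \<in> M"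
  then obtain U where U: "open U" "p \<in> U" "smooth_map (M \<inter> U) f"
    using assms by blast
  have "p \<in> M \<inter> U"
    using \<open>p \<in> M\<close> U(2) by simp
  with U(3) obtain V F
    where "open V" "p \<in> V" "smooth_on V F" "\<And>x. x \<in> M \<inter> U \<inter> V \<Longrightarrow> F x = f x"
    by (rule smooth_mapE) blast
  then show "\<exists>U F. open U \<and> p \<in> U \<and> smooth_on U F \<and> (\<forall>x\<in>M \<inter> U. F x = f x)"
    using U by (intro exI[of _ "U \<inter> V"] exI[of _ F]) (auto intro: smooth_on_subset)
qed

lemma smooth_map_const: "smooth_map M (\<lambda>x. c)"
  by (rule smooth_mapI, rule exI[of _ UNIV], rule exI[of _ "\<lambda>x. c"]) (simp add: smooth_on_def)

lemma smooth_map_linear_image: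
  assumes "bounded_linear L" "smooth_map M f"
  shows "smooth_map M (\<lambda>x. L (f x))"
proof (rule smooth_mapI)
  fix p assume "p \<in> M"
  with assms(2) obtain U F where U: "open U" "p \<in> U" "smooth_on U F" "\<And>x. x \<in> M \<inter> U \<Longrightarrow> F x = f x"
    by (rule smooth_mapE) blast
  then have "smooth_on U (\<lambda>x. L (F x))"
    by (simp add: smooth_on_def Ck_on_linear_image[OF _ assms(1)])
  with U show "\<exists>U F. open U \<and> p \<in> U \<and> smooth_on U F \<and> (\<forall>x\<in>M \<inter> U. F x = L (f x))"
    by (intro exI[of _ U] exI[of _ "\<lambda>x. L (F x)"]) auto
qed

lemma smooth_map_bilinear:
  assumes "bounded_bilinear bil" "smooth_map M f" "smooth_map M h"
  shows "smooth_map M (\<lambda>x. bil (f x) (h x))"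
proof (rule smooth_mapI)
  fix p assume "p \<in> M"
  obtain U F where U: "open U" "p \<in> U" "smooth_on U F" "\<And>x. x \<in> M \<inter> U \<Longrightarrow> F x = f x"
    using assms(2) \<open>p \<in> M\<close> by (rule smooth_mapE) blast
  obtain V H where V: "open V" "p \<in> V" "smooth_on V H" "\<And>x. x \<in> M \<inter> V \<Longrightarrow> H x = h x"
    using assms(3) \<open>p \<in> M\<close> by (rule smooth_mapE) blast
  have "smooth_on (U \<inter> V) (\<lambda>x. bil (F x) (H x))"
    using smooth_on_subset[OF U(3)] smooth_on_subset[OF V(3)] U(1) V(1)
    by (simp add: smooth_on_def Ck_on_bilinear[OF _ assms(1)] open_Int)
  then show "\<exists>U F. open U \<and> p \<in> U \<and> smooth_on U F \<and> (\<forall>x\<in>M \<inter> U. F x = bil (f x) (h x))"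
    using U V by (intro exI[of _ "U \<inter> V"] exI[of _ "\<lambda>x. bil (F x) (H x)"]) auto
qed

lemma smooth_map_add:
  assumes "smooth_map M f" "smooth_map M h"
  shows "smooth_map M (\<lambda>x. f x + h x)"
proof (rule smooth_mapI)
  fix p assume "p \<in> M"
  obtain U F where U: "open U" "p \<in> U" "smooth_on U F" "\<And>x. x \<in> M \<inter> U \<Longrightarrow> F x = f x"
    using assms(1) \<open>p \<in> M\<close> by (rule smooth_mapE) blast
  obtain V H where V: "open V" "p \<in> V" "smooth_on V H" "\<And>x. x \<in> M \<inter> V \<Longrightarrow> H x = h x"
    using assms(2) \<open>p \<in> M\<close> by (rule smooth_mapE) blast
  have "smooth_on (U \<inter> V) (\<lambda>x. F x + H x)"
    using smooth_on_subset[OF U(3)] smooth_on_subset[OF V(3)] U(1) V(1)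
    by (simp add: smooth_on_def Ck_on_add open_Int)
  then show "\<exists>U F. open U \<and> p \<in> U \<and> smooth_on U F \<and> (\<forall>x\<in>M \<inter> U. F x = f x + h x)"
    using U V by (intro exI[of _ "U \<inter> V"] exI[of _ "\<lambda>x. F x + H x"]) auto
qed

lemma smooth_map_diff:
  assumes "smooth_map M f" "smooth_map M h"
  shows "smooth_map M (\<lambda>x. f x - h x)"
  using smooth_map_add[OF assms(1)
      smooth_map_linear_image[OF bounded_linear_minus[OF bounded_linear_ident] assms(2)]]
  by simp

lemma smooth_map_sum: "(\<And>i. i \<in> I \<Longrightarrow> smooth_map M (f i)) \<Longrightarrow> smooth_map M (\<lambda>x. \<Sum>i\<in>I. f i x)"
  by (induction I rule: infinite_finite_induct) (auto intro!: smooth_map_add smooth_map_const)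

lemma smooth_map_basis_blinfun:
  assumes "\<And>b. b \<in> Basis \<Longrightarrow> smooth_map M (\<lambda>x. f x b)"
  shows "smooth_map M (\<lambda>x. basis_blinfun (f x))"
  unfolding basis_blinfun_def
  by (intro smooth_map_sum smooth_map_linear_image[OF bounded_linear_basis_summand] assms)

text \<open>An extension of an invertible operator field need not be invertible, but it stays so near the
  given point.\<close>

lemma smooth_map_blinfun_inv:
  fixes A :: "'a::euclidean_space \<Rightarrow> 'b::euclidean_space \<Rightarrow>\<^sub>L 'b"
  assumes "smooth_map M A" "\<And>x. x \<in> M \<Longrightarrow> inj (blinfun_apply (A x))"
  shows "smooth_map M (\<lambda>x. blinfun_inv (A x))"
proof (rule smooth_mapI)
  fix p assume "p \<in> M"
  with assms(1) obtain U F
    where U: "open U" "p \<in> U" "smooth_on U F" "\<And>x. x \<in> M \<inter> U \<Longrightarrow> F x = A x"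
    by (rule smooth_mapE) blast
  have injp: "inj (blinfun_apply (F p))"
    using assms(2) U \<open>p \<in> M\<close> by simp
  define W where "W = U \<inter> F -` {B. norm (B - F p) * (2 * norm (blinfun_inv (F p))) < 1}"
  have "continuous_on U F"
    using U(3) Ck_on.simps(1) unfolding smooth_on_def by blast
  then have "open W"
    unfolding W_def
    by (intro continuous_open_preimage U open_Collect_less continuous_intros)
  moreover have "p \<in> W"
    using U by (simp add: W_def)
  moreover have "smooth_on W (\<lambda>x. blinfun_inv (F x))"
    using U(3) perturbed_inj[OF injp] \<open>open W\<close>
    by (auto simp: smooth_on_def W_def intro!: Ck_on_blinfun_inv elim: Ck_on_subset)
  ultimately show "\<exists>U F. open U \<and> p \<in> U \<and> smooth_on U F \<and> (\<forall>x\<in>M \<inter> U. F x = blinfun_inv (A x))"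
    using U(4) by (intro exI[of _ W] exI[of _ "\<lambda>x. blinfun_inv (F x)"]) (auto simp: W_def)
qed

section \<open>Local retractions and tangent spaces\<close>

definition local_retraction :: "'a::euclidean_space set \<Rightarrow> 'a set \<Rightarrow> ('a \<Rightarrow> 'a) \<Rightarrow> bool" where
  "local_retraction M U r \<longleftrightarrow>
     open U \<and> smooth_on U r \<and> r ` U \<subseteq> M \<and> (\<forall>x\<in>M \<inter> U. r x = x)"

text \<open>In a chart flattening the submanifold to a subspace \<open>S\<close>, a linear projection onto \<open>S\<close> is a
  retraction; it is defined where the projected point stays in the chart.\<close>

lemma embedded_submanifold_local_retraction:
  fixes M :: "'a::euclidean_space set"
  assumes "embedded_submanifold d M" "p \<in> M"
  obtains U r where "local_retraction M U r" "p \<in> U"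
proof -
  obtain U \<phi> \<psi> S and V :: "'a set" where chart: "open U" "p \<in> U" "open V" "homeomorphism U V \<phi> \<psi>"
      "smooth_on U \<phi>" "smooth_on V \<psi>" "subspace S" "\<phi> ` (M \<inter> U) = V \<inter> S"
    using bspec[OF assms(1)[unfolded embedded_submanifold_def] assms(2)] by (elim exE conjE) metis
  obtain \<pi> :: "'a \<Rightarrow> 'a" where "range \<pi> \<subseteq> S" "linear \<pi>" "\<forall>v\<in>S. \<pi> (id v) = v"
    using linear_exists_left_inverse_on[OF linear_id \<open>subspace S\<close> inj_on_id]
    by (elim exE conjE) (rule that)
  then have \<pi>: "linear \<pi>" "range \<pi> \<subseteq> S" "\<And>v. v \<in> S \<Longrightarrow> \<pi> v = v"
    by simp_all
  have bl: "bounded_linear \<pi>"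
    using \<pi>(1) by (simp add: linear_linear)
  have \<psi>\<phi>: "\<psi> (\<phi> x) = x" if "x \<in> U" for x
    using chart(4) that by (simp add: homeomorphism_def)
  define W where "W = U \<inter> (\<lambda>x. \<pi> (\<phi> x)) -` V"
  have cont: "continuous_on U (\<lambda>x. \<pi> (\<phi> x))"
    using bounded_linear.continuous_on[OF bl, of U \<phi>] chart(4) by (simp add: homeomorphism_def)
  have "open W"
    unfolding W_def using cont chart by (intro continuous_open_preimage)
  have fixed: "\<pi> (\<phi> x) = \<phi> x" "\<phi> x \<in> V" if "x \<in> M" "x \<in> U" for x
  proof -
    have "\<phi> x \<in> V \<inter> S"
      using that by (simp flip: chart(8))
    then show "\<pi> (\<phi> x) = \<phi> x" "\<phi> x \<in> V"
      by (simp_all add: \<pi>(3))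
  qed
  have "smooth_on W (\<lambda>x. \<psi> (\<pi> (\<phi> x)))"
    unfolding smooth_on_def
  proof (intro allI, rule Ck_on_compose[where V = V and f = "\<lambda>x. \<pi> (\<phi> x)" and h = \<psi>])
    show "Ck_on k W (\<lambda>x. \<pi> (\<phi> x))" for k
      using smooth_on_subset[OF chart(5), of W] \<open>open W\<close>
      by (simp add: smooth_on_def W_def Ck_on_linear_image[OF _ bl])
  qed (use chart \<open>open W\<close> in \<open>auto simp: W_def smooth_on_def\<close>)
  moreover have "\<psi> (\<pi> (\<phi> x)) \<in> M" if "x \<in> W" for x
  proof -
    have "\<pi> (\<phi> x) \<in> \<phi> ` (M \<inter> U)"
      using that \<pi>(2) chart(8) by (simp add: W_def image_subset_iff)
    then obtain m where "m \<in> M" "m \<in> U" "\<pi> (\<phi> x) = \<phi> m"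
      by blast
    then show ?thesis
      using \<psi>\<phi> by simp
  qed
  moreover have "\<psi> (\<pi> (\<phi> x)) = x" if "x \<in> M \<inter> W" for x
    using that fixed \<psi>\<phi> by (auto simp: W_def)
  ultimately have "local_retraction M W (\<lambda>x. \<psi> (\<pi> (\<phi> x)))"
    using \<open>open W\<close> by (auto simp: local_retraction_def)
  moreover have "p \<in> W"
    using assms(2) chart fixed by (auto simp: W_def)
  ultimately show ?thesis
    by (rule that)
qed

lemma curve_in_stays:
  assumes "curve_in M x v \<gamma>" "open U" "x \<in> U"
  obtains N where "open N" "0 \<in> N" "\<And>t. t \<in> N \<Longrightarrow> \<gamma> t \<in> M \<inter> U"
proof -
  obtain e where e: "e > 0" "\<forall>t\<in>{-e<..<e}. \<gamma> t \<in> M"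
    using assms(1) unfolding curve_in_def by blast
  have "isCont \<gamma> 0" and "\<gamma> 0 = x"
    using assms(1) by (auto simp: curve_in_def intro: has_vector_derivative_continuous)
  with assms(2,3) obtain N where "open N" "0 \<in> N" "\<forall>t\<in>N. \<gamma> t \<in> U"
    unfolding continuous_at_open by blast
  with e show ?thesis
    by (intro that[of "N \<inter> {-e<..<e}"]) auto
qed

lemma curve_in_base: "curve_in M x v \<gamma> \<Longrightarrow> x \<in> M"
  by (rule curve_in_stays[of M x v \<gamma> UNIV]) (auto simp: curve_in_def)

lemma curve_in_composite_derivative:
  assumes "curve_in M x v \<gamma>" "open U" "x \<in> U" "(F has_derivative F') (at x)"
    and "\<And>y. y \<in> M \<inter> U \<Longrightarrow> F y = f y"
  shows "((\<lambda>t. f (\<gamma> t)) has_vector_derivative F' v) (at 0)"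
proof -
  have \<gamma>': "(\<gamma> has_derivative (\<lambda>t. t *\<^sub>R v)) (at 0)" and "\<gamma> 0 = x"
    using assms(1) by (simp_all add: curve_in_def has_vector_derivative_def)
  then have "((\<lambda>t. F (\<gamma> t)) has_derivative (\<lambda>t. F' (t *\<^sub>R v))) (at 0)"
    using has_derivative_compose[OF \<gamma>', of F F'] assms(4) by simp
  moreover have "F' (t *\<^sub>R v) = t *\<^sub>R F' v" for t
    using has_derivative_linear[OF assms(4)] by (simp add: linear_scale)
  ultimately have deriv: "((\<lambda>t. F (\<gamma> t)) has_vector_derivative F' v) (at 0)"
    by (simp add: has_vector_derivative_def)
  obtain N where N: "open N" "0 \<in> N" "\<And>t. t \<in> N \<Longrightarrow> \<gamma> t \<in> M \<inter> U"
    using assms(1-3) by (rule curve_in_stays) blast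
  from deriv N(1,2) show ?thesis
    by (rule has_vector_derivative_transform_within_open) (rule assms(5), rule N(3))
qed

text \<open>A curve in the submanifold is unchanged by \<open>r\<close>; differentiate \<open>r \<circ> \<gamma> = \<gamma>\<close>.\<close>

lemma local_retraction_fixes_tangent:
  assumes "local_retraction M U r" "x \<in> U" "v \<in> tangent_space M x"
  shows "frechet_derivative r (at x) v = v"
proof -
  obtain \<gamma> where \<gamma>: "curve_in M x v \<gamma>"
    using assms(3) by (auto simp: tangent_space_def)
  have "((\<lambda>t. \<gamma> t) has_vector_derivative frechet_derivative r (at x) v) (at 0)"
    using assms
    by (intro curve_in_composite_derivative[OF \<gamma>, of U r] smooth_on_has_derivative[of U])
      (auto simp: local_retraction_def)
  moreover have "(\<gamma> has_vector_derivative v) (at 0)"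
    using \<gamma> by (simp add: curve_in_def)
  ultimately show ?thesis
    by (simp add: vector_derivative_unique_at)
qed

text \<open>A tangent vector \<open>Dr w\<close> is realised by the retracted line \<open>t \<mapsto> r (x + t w)\<close>.\<close>

lemma local_retraction_derivative_tangent:
  assumes r: "local_retraction M U r" and x: "x \<in> M" "x \<in> U"
  shows "frechet_derivative r (at x) w \<in> tangent_space M x"
proof -
  obtain \<epsilon> where \<epsilon>: "\<epsilon> > 0" "ball x \<epsilon> \<subseteq> U"
    using r x(2) by (auto simp: local_retraction_def open_contains_ball)
  define e where "e = \<epsilon> / (norm w + 1)"
  have "e > 0"
    using \<epsilon>(1) by (simp add: e_def add_nonneg_pos)
  let ?line = "\<lambda>t. x + t *\<^sub>R w"
  have line: "?line t \<in> U" if "t \<in> {-e<..<e}" for t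
  proof -
    have "\<bar>t\<bar> < \<epsilon> / (norm w + 1)"
      using that by (auto simp: e_def)
    then have "\<bar>t\<bar> * (norm w + 1) < \<epsilon>"
      by (simp add: pos_less_divide_eq add_nonneg_pos)
    moreover have "\<bar>t\<bar> * norm w \<le> \<bar>t\<bar> * (norm w + 1)"
      by (simp add: mult_left_mono)
    ultimately have "dist x (?line t) < \<epsilon>"
      by (simp add: dist_norm)
    then show ?thesis
      using \<epsilon>(2) by auto
  qed
  have deriv: "(r has_derivative frechet_derivative r (at x)) (at x)"
    using r x(2) by (auto simp: local_retraction_def intro: smooth_on_has_derivative)
  have "(?line has_derivative (\<lambda>t. t *\<^sub>R w)) (at 0)"
    by (auto intro!: derivative_eq_intros)
  then have "((\<lambda>t. r (?line t)) has_derivative (\<lambda>t. frechet_derivative r (at x) (t *\<^sub>R w))) (at 0)"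
    by (rule has_derivative_compose) (simp add: deriv)
  moreover have "frechet_derivative r (at x) (t *\<^sub>R w) = t *\<^sub>R frechet_derivative r (at x) w" for t
    using has_derivative_linear[OF deriv] by (simp add: linear_scale)
  ultimately have "((\<lambda>t. r (?line t)) has_vector_derivative frechet_derivative r (at x) w) (at 0)"
    by (simp add: has_vector_derivative_def)
  moreover have "smooth_on {-e<..<e} (\<lambda>t. r (?line t))"
    unfolding smooth_on_def
  proof (intro allI, rule Ck_on_compose[where V = U and f = ?line and h = r])
    show "Ck_on k {-e<..<e} ?line" for k
      by (intro Ck_on_add Ck_on_const Ck_on_bounded_linear bounded_linear_scaleR_left) auto
  qed (use r line in \<open>auto simp: local_retraction_def smooth_on_def\<close>)
  moreover have "r (?line t) \<in> M" if "t \<in> {-e<..<e}" for t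
    using line[OF that] r by (auto simp: local_retraction_def)
  moreover have "r x = x"
    using r x by (simp add: local_retraction_def)
  ultimately have "curve_in M x (frechet_derivative r (at x) w) (\<lambda>t. r (?line t))"
    using \<open>e > 0\<close> by (auto simp: curve_in_def intro!: exI[of _ e])
  then show ?thesis
    by (auto simp: tangent_space_def)
qed

lemma subspace_tangent_space:
  assumes "embedded_submanifold d M" "x \<in> M"
  shows "subspace (tangent_space M x)"
proof -
  obtain U r where r: "local_retraction M U r" "x \<in> U"
    using assms by (rule embedded_submanifold_local_retraction)
  then have "tangent_space M x = range (frechet_derivative r (at x))"
    using local_retraction_fixes_tangent[OF r] local_retraction_derivative_tangent[OF r(1) assms(2) r(2)]
    by (auto simp: image_iff) metis
  moreover have "linear (frechet_derivative r (at x))"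
    using r smooth_on_has_derivative[of U r x] has_derivative_linear
    by (auto simp: local_retraction_def)
  ultimately show ?thesis
    by (simp add: linear_subspace_image subspace_UNIV)
qed

section \<open>Directional derivatives along the submanifold\<close>

lemma dir_deriv_eqI:
  assumes "v \<in> tangent_space M x"
    and "\<And>\<gamma>. curve_in M x v \<gamma> \<Longrightarrow> ((\<lambda>t. f (\<gamma> t)) has_vector_derivative w) (at 0)"
  shows "dir_deriv M f x v = w"
  unfolding dir_deriv_def
proof (rule the_equality)
  fix w' assume *: "\<forall>\<gamma>. curve_in M x v \<gamma> \<longrightarrow> ((\<lambda>t. f (\<gamma> t)) has_vector_derivative w') (at 0)"
  obtain \<gamma> where "curve_in M x v \<gamma>"
    using assms(1) by (auto simp: tangent_space_def)
  then show "w' = w"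
    using * assms(2) vector_derivative_unique_at by blast
qed (use assms(2) in blast)

text \<open>The chain rule along curves makes the Frechet derivative of any extension compute the directional
  derivative; linearity in the direction and smoothness are inherited from it.\<close>

lemma dir_deriv_extension:
  assumes "open U" "x \<in> U" "(F has_derivative F') (at x)" "\<And>y. y \<in> M \<inter> U \<Longrightarrow> F y = f y"
    and "v \<in> tangent_space M x"
  shows "dir_deriv M f x v = F' v"
  using assms by (intro dir_deriv_eqI curve_in_composite_derivative[of M x v _ U F])

lemma smooth_map_dir_deriv_curve:
  assumes "smooth_map M f" "curve_in M x v \<gamma>"
  shows "((\<lambda>t. f (\<gamma> t)) has_vector_derivative dir_deriv M f x v) (at 0)"
proof -
  obtain U F where U: "open U" "x \<in> U" "smooth_on U F" "\<And>y. y \<in> M \<inter> U \<Longrightarrow> F y = f y"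
    using assms(1) curve_in_base[OF assms(2)] by (rule smooth_mapE) blast
  note F' = smooth_on_has_derivative[OF U(3,2)]
  have "v \<in> tangent_space M x"
    using assms(2) by (auto simp: tangent_space_def)
  then show ?thesis
    using curve_in_composite_derivative[OF assms(2) U(1,2) F' U(4)]
      dir_deriv_extension[OF U(1,2) F' U(4)] by simp
qed

lemma dir_deriv_cong:
  assumes "smooth_map M f" "\<And>y. y \<in> M \<Longrightarrow> h y = f y" "v \<in> tangent_space M x"
  shows "dir_deriv M h x v = dir_deriv M f x v"
proof (rule dir_deriv_eqI[OF assms(3)])
  fix \<gamma> assume \<gamma>: "curve_in M x v \<gamma>"
  obtain N where N: "open N" "0 \<in> N" "\<And>t. t \<in> N \<Longrightarrow> \<gamma> t \<in> M \<inter> UNIV"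
    using \<gamma> open_UNIV UNIV_I by (rule curve_in_stays) blast
  from smooth_map_dir_deriv_curve[OF assms(1) \<gamma>] N(1,2)
  show "((\<lambda>t. h (\<gamma> t)) has_vector_derivative dir_deriv M f x v) (at 0)"
    by (rule has_vector_derivative_transform_within_open) (rule assms(2)[symmetric], use N(3) in simp)
qed

lemma dir_deriv_bilinear:
  assumes "bounded_bilinear bil" "smooth_map M f" "smooth_map M h" "v \<in> tangent_space M x"
  shows "dir_deriv M (\<lambda>y. bil (f y) (h y)) x v
    = bil (f x) (dir_deriv M h x v) + bil (dir_deriv M f x v) (h x)"
proof (rule dir_deriv_eqI[OF assms(4)])
  fix \<gamma> assume \<gamma>: "curve_in M x v \<gamma>"
  then have "\<gamma> 0 = x"
    by (simp add: curve_in_def)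
  with bounded_bilinear.has_vector_derivative[OF assms(1)
      smooth_map_dir_deriv_curve[OF assms(2) \<gamma>] smooth_map_dir_deriv_curve[OF assms(3) \<gamma>]]
  show "((\<lambda>t. bil (f (\<gamma> t)) (h (\<gamma> t))) has_vector_derivative
      bil (f x) (dir_deriv M h x v) + bil (dir_deriv M f x v) (h x)) (at 0)"
    by simp
qed

lemma dir_deriv_bounded_linear:
  assumes "bounded_linear L" "smooth_map M f" "v \<in> tangent_space M x"
  shows "dir_deriv M (\<lambda>y. L (f y)) x v = L (dir_deriv M f x v)"
  by (intro dir_deriv_eqI[OF assms(3)] bounded_linear.has_vector_derivative[OF assms(1)]
      smooth_map_dir_deriv_curve[OF assms(2)])

lemma dir_deriv_linear_in_direction:
  assumes "smooth_map M f" "x \<in> M"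
  obtains L where "linear L" "\<And>v. v \<in> tangent_space M x \<Longrightarrow> dir_deriv M f x v = L v"
proof -
  obtain U F where U: "open U" "x \<in> U" "smooth_on U F" "\<And>y. y \<in> M \<inter> U \<Longrightarrow> F y = f y"
    using assms by (rule smooth_mapE) blast
  note F' = smooth_on_has_derivative[OF U(3,2)]
  show ?thesis
    using that[OF has_derivative_linear[OF F']] dir_deriv_extension[OF U(1,2) F' U(4)] by blast
qed

text \<open>The direction now moves with the point; expanding it in the standard basis of the ambient space
  leaves derivatives of an extension in fixed directions.\<close>

lemma smooth_map_dir_deriv:
  fixes f :: "'a::euclidean_space \<Rightarrow> 'b::real_normed_vector"
  assumes "smooth_map M f" "vector_field M X"
  shows "smooth_map M (\<lambda>x. dir_deriv M f x (X x))"
proof (rule smooth_map_local)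
  fix p assume "p \<in> M"
  with assms(1) obtain U F where U: "open U" "p \<in> U" "smooth_on U F" "\<And>y. y \<in> M \<inter> U \<Longrightarrow> F y = f y"
    by (rule smooth_mapE) blast
  let ?F' = "\<lambda>x. frechet_derivative F (at x)"
  have "smooth_map M X"
    using assms(2) by (simp add: vector_field_def)
  then have "smooth_map (M \<inter> U) X"
    by (rule smooth_map_subset) simp
  then have smooth: "smooth_map (M \<inter> U) (\<lambda>x. \<Sum>b\<in>Basis. (X x \<bullet> b) *\<^sub>R ?F' x b)"
    by (intro smooth_map_sum smooth_map_bilinear[OF bounded_bilinear_scaleR]
        smooth_map_linear_image[OF bounded_linear_inner_left]
        smooth_on_imp_smooth_map[OF U(1) smooth_on_frechet_derivative[OF U(3)]])
  have "(\<Sum>b\<in>Basis. (X x \<bullet> b) *\<^sub>R ?F' x b) = dir_deriv M f x (X x)" if "x \<in> M \<inter> U" for x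
  proof -
    have F': "(F has_derivative ?F' x) (at x)"
      using U(3) that by (intro smooth_on_has_derivative[of U]) auto
    have "X x \<in> tangent_space M x"
      using assms(2) that by (simp add: vector_field_def)
    then have "dir_deriv M f x (X x) = ?F' x (X x)"
      using that by (intro dir_deriv_extension[OF U(1) _ F' U(4)]) auto
    also have "\<dots> = basis_blinfun (?F' x) (X x)"
      by (simp add: basis_blinfun_linear has_derivative_linear[OF F'])
    finally show ?thesis
      by (simp add: basis_blinfun_apply)
  qed
  then have "smooth_map (M \<inter> U) (\<lambda>x. dir_deriv M f x (X x))"
    by (rule smooth_map_cong[OF smooth])
  then show "\<exists>U. open U \<and> p \<in> U \<and> smooth_map (M \<inter> U) (\<lambda>x. dir_deriv M f x (X x))"
    using U by blast
qed

section \<open>The projection field of an ambient structure\<close>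

text \<open>Written as a sum over the basis, the adjoint is visibly a bounded linear function of the values of
  \<open>A\<close> and hence smooth in \<open>A\<close>.\<close>

definition blinfun_adjoint ::
  "('a::euclidean_space \<Rightarrow>\<^sub>L 'b::euclidean_space) \<Rightarrow> 'b \<Rightarrow>\<^sub>L 'a" where
  "blinfun_adjoint A = (\<Sum>b\<in>Basis. blinfun_scaleR_left b o\<^sub>L blinfun_inner_right (A b))"

lemma blinfun_adjoint_inner: "blinfun_adjoint A v \<bullet> w = v \<bullet> A w"
proof -
  have "A w = (\<Sum>b\<in>Basis. (w \<bullet> b) *\<^sub>R A b)"
    using basis_blinfun_linear[OF blinfun_linear[of A], of w] by (simp add: basis_blinfun_apply)
  then show ?thesis
    by (simp add: blinfun_adjoint_def blinfun.sum_left blinfun_inner_right.rep_eq inner_sum_left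
        inner_sum_right inner_commute mult.commute)
qed

lemma smooth_map_blinfun_adjoint:
  assumes "smooth_map M A"
  shows "smooth_map M (\<lambda>x. blinfun_adjoint (A x))"
proof -
  have lin: "bounded_linear (\<lambda>w. blinfun_scaleR_left b o\<^sub>L blinfun_inner_right w)" for b
    by (rule bounded_linear_compose[OF
          bounded_bilinear.bounded_linear_right[OF bounded_bilinear_blinfun_compose]
          bounded_linear_blinfun_inner_right])
  show ?thesis
    unfolding blinfun_adjoint_def
    by (intro smooth_map_sum smooth_map_linear_image[OF lin]
        smooth_map_linear_image[OF blinfun.bounded_linear_left] assms)
qed

locale ambient =
  fixes d :: nat and M :: "'a::euclidean_space set" and \<rho> :: "'a \<Rightarrow> 'a \<Rightarrow> 'a \<Rightarrow> real"
    and g :: "'a \<Rightarrow> 'a \<Rightarrow>\<^sub>L 'a"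
  assumes ambient_structure: "ambient_structure d M \<rho> g"
begin

abbreviation T :: "'a \<Rightarrow> 'a set" where "T \<equiv> tangent_space M"
abbreviation proj :: "'a \<Rightarrow> 'a \<Rightarrow>\<^sub>L 'a" where "proj \<equiv> proj_g M g"

lemma submanifold: "embedded_submanifold d M"
  and smooth_metric: "smooth_map M g"
  and metric_sym: "x \<in> M \<Longrightarrow> g x u \<bullet> v = u \<bullet> g x v"
  and metric_pos: "x \<in> M \<Longrightarrow> u \<noteq> 0 \<Longrightarrow> 0 < u \<bullet> g x u"
  and metric_\<rho>: "x \<in> M \<Longrightarrow> \<xi> \<in> T x \<Longrightarrow> \<eta> \<in> T x \<Longrightarrow> \<rho> x \<xi> \<eta> = \<xi> \<bullet> g x \<eta>"
  using ambient_structure by (auto simp: ambient_structure_def metric_operator_def)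

lemma metric_swap: "x \<in> M \<Longrightarrow> u \<bullet> g x v = v \<bullet> g x u"
  using metric_sym[of x u v] by (simp add: inner_commute)

lemma subspace_T: "x \<in> M \<Longrightarrow> subspace (T x)"
  using submanifold by (rule subspace_tangent_space)

lemma metric_inj:
  assumes x: "x \<in> M"
  shows "inj (blinfun_apply (g x))"
proof -
  have "u = 0" if "g x u = 0" for u
    using metric_pos[OF x, of u] that by force
  then show ?thesis
    by (simp add: linear_injective_0[OF blinfun_linear])
qed

lemmas metric_surj = metric_inj[THEN inj_blinfun_surj]

lemma tangent_orthogonal_zero:
  assumes "x \<in> M" "v \<in> T x" "\<And>\<phi>. \<phi> \<in> T x \<Longrightarrow> v \<bullet> g x \<phi> = 0"
  shows "v = 0"
  using metric_pos[OF assms(1)] assms(2,3) by force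

lemma proj_g_eqI:
  fixes P :: "'a \<Rightarrow>\<^sub>L 'a"
  assumes x: "x \<in> M"
    and P: "\<And>\<omega>. P \<omega> \<in> T x" "\<And>\<omega> \<xi>. \<xi> \<in> T x \<Longrightarrow> \<xi> \<bullet> g x (\<omega> - P \<omega>) = 0"
  shows "proj x = P"
  unfolding proj_g_def
proof (rule the_equality)
  fix P' :: "'a \<Rightarrow>\<^sub>L 'a"
  assume P': "\<forall>\<omega>. P' \<omega> \<in> T x \<and> (\<forall>\<xi>\<in>T x. inner_g g x \<xi> (\<omega> - P' \<omega>) = 0)"
  have "P' \<omega> - P \<omega> = 0" for \<omega>
  proof (rule tangent_orthogonal_zero[OF x])
    show "P' \<omega> - P \<omega> \<in> T x"
      using P P' subspace_T[OF x] by (simp add: subspace_diff)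
    show "(P' \<omega> - P \<omega>) \<bullet> g x \<phi> = 0" if "\<phi> \<in> T x" for \<phi>
    proof -
      have "\<phi> \<bullet> g x (\<omega> - P \<omega>) - \<phi> \<bullet> g x (\<omega> - P' \<omega>) = 0"
        using P(2)[OF that, of \<omega>] P' that by (simp add: inner_g_def)
      then show ?thesis
        unfolding metric_swap[OF x, of "P' \<omega> - P \<omega>" \<phi>]
        by (simp add: blinfun.diff_right inner_diff_right)
    qed
  qed
  then show "P' = P"
    by (intro blinfun_eqI) simp
qed (use P in \<open>simp add: inner_g_def\<close>)

text \<open>
  Let \<open>Q\<close> be the derivative of a local retraction: an idempotent onto the tangent space, smooth
  but in general not orthogonal for the metric. The operator \<open>C = Q\<^sup>T g Q + (1 - Q)\<^sup>T (1 - Q)\<close> is positive definite.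
  If \<open>C t = Q\<^sup>T g \<omega>\<close>, pairing with vectors in the kernel of \<open>Q\<close> gives \<open>t = Q t\<close>, and pairing with
  tangent vectors gives that \<open>\<omega> - t\<close> is \<open>g\<close>-orthogonal to the tangent space. Hence the orthogonal
  projection is \<open>C\<inverse> Q\<^sup>T g\<close>, a smooth expression.
\<close>

lemma smooth_orthogonal_projection:
  assumes "p \<in> M"
  obtains U and P :: "'a \<Rightarrow> 'a \<Rightarrow>\<^sub>L 'a" where "open U" "p \<in> U" "smooth_map (M \<inter> U) P"
    "\<And>x \<omega>. x \<in> M \<inter> U \<Longrightarrow> P x \<omega> \<in> T x"
    "\<And>x \<omega> \<xi>. x \<in> M \<inter> U \<Longrightarrow> \<xi> \<in> T x \<Longrightarrow> \<xi> \<bullet> g x (\<omega> - P x \<omega>) = 0"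
proof -
  obtain U r where r: "local_retraction M U r" "p \<in> U"
    using submanifold assms by (rule embedded_submanifold_local_retraction)
  have U: "open U" "smooth_on U r"
    using r(1) by (auto simp: local_retraction_def)
  define Q where "Q x = basis_blinfun (frechet_derivative r (at x))" for x
  have Q_apply: "Q x v = frechet_derivative r (at x) v" if "x \<in> U" for x v
    using has_derivative_linear[OF smooth_on_has_derivative[OF U(2) that]]
    by (simp add: Q_def basis_blinfun_linear)
  have Q_range: "Q x v \<in> T x" if "x \<in> M \<inter> U" for x v
    using local_retraction_derivative_tangent[OF r(1)] that by (simp add: Q_apply)
  have Q_fix: "Q x v = v" if "x \<in> M \<inter> U" "v \<in> T x" for x v
    using local_retraction_fixes_tangent[OF r(1)] that by (simp add: Q_apply)
  define C where "C x = (blinfun_adjoint (Q x) o\<^sub>L (g x o\<^sub>L Q x)) +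
    (blinfun_adjoint (id_blinfun - Q x) o\<^sub>L (id_blinfun - Q x))" for x
  have C_inner: "C x u \<bullet> v = g x (Q x u) \<bullet> Q x v + (u - Q x u) \<bullet> (v - Q x v)" for x u v
    by (simp add: C_def blinfun.add_left inner_add_left blinfun_adjoint_inner blinfun.diff_left)
  have C_inj: "inj (blinfun_apply (C x))" if x: "x \<in> M \<inter> U" for x
  proof -
    have "u = 0" if "C x u = 0" for u
    proof -
      have 0: "Q x u \<bullet> g x (Q x u) + (u - Q x u) \<bullet> (u - Q x u) = 0"
        using C_inner[of x u u] that by (simp add: inner_commute)
      have "0 \<le> Q x u \<bullet> g x (Q x u)"
        using metric_pos[of x "Q x u"] x by (cases "Q x u = 0") auto
      with 0 have "(u - Q x u) \<bullet> (u - Q x u) = 0" "Q x u \<bullet> g x (Q x u) = 0"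
        using inner_ge_zero[of "u - Q x u"] by linarith+
      then show ?thesis
        using metric_pos[of x "Q x u"] x by force
    qed
    then show ?thesis
      by (simp add: linear_injective_0[OF blinfun_linear])
  qed
  define P where "P x = blinfun_inv (C x) o\<^sub>L (blinfun_adjoint (Q x) o\<^sub>L g x)" for x
  have key: "g x (Q x (P x \<omega>)) \<bullet> Q x v + (P x \<omega> - Q x (P x \<omega>)) \<bullet> (v - Q x v) = g x \<omega> \<bullet> Q x v"
    if "x \<in> M \<inter> U" for x \<omega> v
    using C_inner[of x "P x \<omega>" v]
    by (simp add: P_def blinfun_inv_right[OF C_inj[OF that]] blinfun_adjoint_inner)
  have QP: "Q x (P x \<omega>) = P x \<omega>" if x: "x \<in> M \<inter> U" for x \<omega>
  proof -
    let ?u = "P x \<omega> - Q x (P x \<omega>)"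
    have "Q x ?u = 0"
      using Q_fix[OF x Q_range[OF x]] by (simp add: blinfun.diff_right)
    then show ?thesis
      using key[OF x, of \<omega> ?u] by simp
  qed
  have smQ: "smooth_map (M \<inter> U) Q"
    unfolding Q_def
    by (intro smooth_map_basis_blinfun smooth_on_imp_smooth_map smooth_on_frechet_derivative U)
  have smg: "smooth_map (M \<inter> U) g"
    using smooth_metric by (rule smooth_map_subset) simp
  note comp = smooth_map_bilinear[OF bounded_bilinear_blinfun_compose]
  have smC: "smooth_map (M \<inter> U) C"
    unfolding C_def
    by (intro smooth_map_add comp smooth_map_blinfun_adjoint smooth_map_diff smooth_map_const smQ smg)
  show ?thesis
  proof (rule that[OF U(1) r(2)])
    show "smooth_map (M \<inter> U) P"
      unfolding P_def
      by (intro comp smooth_map_blinfun_adjoint smooth_map_blinfun_inv smQ smg smC C_inj)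
    show "P x \<omega> \<in> T x" if "x \<in> M \<inter> U" for x \<omega>
      using Q_range[OF that, of "P x \<omega>"] QP[OF that] by simp
    show "\<xi> \<bullet> g x (\<omega> - P x \<omega>) = 0" if "x \<in> M \<inter> U" "\<xi> \<in> T x" for x \<omega> \<xi>
      using key[OF that(1), of \<omega> \<xi>] QP[OF that(1)] Q_fix[OF that]
      by (simp add: blinfun.diff_right inner_diff_right inner_commute)
  qed
qed

lemma proj_g_tangent: "x \<in> M \<Longrightarrow> proj x \<omega> \<in> T x"
  and proj_g_orthogonal: "x \<in> M \<Longrightarrow> \<xi> \<in> T x \<Longrightarrow> \<xi> \<bullet> g x (\<omega> - proj x \<omega>) = 0"
  and smooth_proj_g: "smooth_map M proj"
proof -
  have ex: "\<exists>U. open U \<and> p \<in> U \<and> smooth_map (M \<inter> U) proj \<and>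
      (\<forall>\<omega>. proj p \<omega> \<in> T p \<and> (\<forall>\<xi>\<in>T p. \<xi> \<bullet> g p (\<omega> - proj p \<omega>) = 0))" if p: "p \<in> M" for p
  proof -
    obtain U and P :: "'a \<Rightarrow> 'a \<Rightarrow>\<^sub>L 'a" where U: "open U" "p \<in> U" "smooth_map (M \<inter> U) P"
      and P: "\<And>x \<omega>. x \<in> M \<inter> U \<Longrightarrow> P x \<omega> \<in> T x"
      "\<And>x \<omega> \<xi>. x \<in> M \<inter> U \<Longrightarrow> \<xi> \<in> T x \<Longrightarrow> \<xi> \<bullet> g x (\<omega> - P x \<omega>) = 0"
      by (rule smooth_orthogonal_projection[OF p]) blast
    have eq: "P x = proj x" if "x \<in> M \<inter> U" for x
      using that by (intro proj_g_eqI[symmetric] P) auto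
    have "smooth_map (M \<inter> U) proj"
      using U(3) by (rule smooth_map_cong) (rule eq)
    then show ?thesis
      using U P[of p] eq[of p] p by (intro exI[of _ U]) simp
  qed
  show "proj x \<omega> \<in> T x" if "x \<in> M"
    using ex[OF that] by blast
  show "\<xi> \<bullet> g x (\<omega> - proj x \<omega>) = 0" if "x \<in> M" "\<xi> \<in> T x"
    using ex[OF that(1)] that(2) by blast
  show "smooth_map M proj"
    by (rule smooth_map_local) (use ex in blast)
qed

lemma proj_g_inner:
  assumes "x \<in> M" "\<phi> \<in> T x"
  shows "proj x \<omega> \<bullet> g x \<phi> = \<omega> \<bullet> g x \<phi>"
  unfolding metric_swap[OF assms(1), of _ \<phi>] using proj_g_orthogonal[OF assms, of \<omega>]
  by (simp add: blinfun.diff_right inner_diff_right)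

lemma proj_g_fixes_tangent: "x \<in> M \<Longrightarrow> v \<in> T x \<Longrightarrow> proj x v = v"
  using tangent_orthogonal_zero[of x "proj x v - v"]
  by (simp add: proj_g_inner proj_g_tangent subspace_T subspace_diff inner_diff_left)

text \<open>Projecting a constant vector extends any tangent vector to a global vector field.\<close>

lemma vector_field_proj: "vector_field M (\<lambda>y. proj y w)"
  unfolding vector_field_def
  using smooth_map_linear_image[OF blinfun.bounded_linear_left smooth_proj_g] proj_g_tangent by blast

lemma inner_metric_inverse: "x \<in> M \<Longrightarrow> inv (blinfun_apply (g x)) w \<bullet> g x \<phi> = w \<bullet> \<phi>"
  using metric_sym[of x "inv (blinfun_apply (g x)) w" \<phi>] by (simp add: surj_f_inv_f metric_surj)

end

section \<open>The Levi-Civita connection in ambient coordinates\<close>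

locale ambient_levi_civita = ambient +
  fixes nabla
  assumes levi_civita: "levi_civita M \<rho> nabla"
begin

lemma vector_field_nabla: "vector_field M X \<Longrightarrow> vector_field M Y \<Longrightarrow> vector_field M (nabla X Y)"
  using levi_civita by (auto simp: levi_civita_def affine_connection_def)

text \<open>The difference between covariant and directional derivative; in general not tangent.\<close>

definition defect :: "('a \<Rightarrow> 'a) \<Rightarrow> ('a \<Rightarrow> 'a) \<Rightarrow> 'a \<Rightarrow> 'a" where
  "defect X Y x = nabla X Y x - dir_deriv M Y x (X x)"

text \<open>Testing the bracket on the ambient linear coordinates gives \<open>[X, Y] = D\<^sub>X Y - D\<^sub>Y X\<close>.\<close>

lemma defect_symmetric:
  assumes X: "vector_field M X" and Y: "vector_field M Y" and x: "x \<in> M"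
  shows "defect X Y x = defect Y X x"
proof -
  let ?Z = "\<lambda>x. nabla X Y x - nabla Y X x"
  have Z: "is_lie_bracket M X Y ?Z"
    using levi_civita X Y by (simp add: levi_civita_def torsion_free_def)
  have "?Z x = dir_deriv M Y x (X x) - dir_deriv M X x (Y x)"
  proof (rule euclidean_eqI)
    fix b :: 'a
    let ?f = "\<lambda>y. y \<bullet> b"
    have smf: "smooth_map M ?f"
      by (rule smooth_mapI, rule exI[of _ UNIV], rule exI[of _ ?f])
        (simp add: smooth_on_def Ck_on_bounded_linear bounded_linear_inner_left)
    have df: "dir_deriv M ?f y v = v \<bullet> b" if "v \<in> T y" for y v
      using that
      by (intro dir_deriv_extension[of UNIV y ?f ?f] bounded_linear_imp_has_derivative
          bounded_linear_inner_left) auto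
    have ddf: "dir_deriv M (\<lambda>y. dir_deriv M ?f y (V y)) x v = dir_deriv M V x v \<bullet> b"
      if V: "vector_field M V" and v: "v \<in> T x" for V v
    proof -
      have smV: "smooth_map M V" and VT: "\<And>y. y \<in> M \<Longrightarrow> V y \<in> T y"
        using V by (auto simp: vector_field_def)
      have "dir_deriv M (\<lambda>y. dir_deriv M ?f y (V y)) x v = dir_deriv M (\<lambda>y. V y \<bullet> b) x v"
        by (rule dir_deriv_cong[OF smooth_map_linear_image[OF bounded_linear_inner_left smV] _ v])
          (simp add: df VT)
      also have "\<dots> = dir_deriv M V x v \<bullet> b"
        by (rule dir_deriv_bounded_linear[OF bounded_linear_inner_left smV v])
      finally show ?thesis .
    qed
    have XY: "X x \<in> T x" "Y x \<in> T x" "?Z x \<in> T x"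
      using X Y Z x by (auto simp: vector_field_def is_lie_bracket_def)
    have "dir_deriv M ?f x (?Z x) = dir_deriv M (\<lambda>y. dir_deriv M ?f y (Y y)) x (X x) -
        dir_deriv M (\<lambda>y. dir_deriv M ?f y (X y)) x (Y x)"
      using Z smf x by (simp add: is_lie_bracket_def)
    then show "?Z x \<bullet> b = (dir_deriv M Y x (X x) - dir_deriv M X x (Y x)) \<bullet> b"
      using XY by (simp add: df ddf X Y inner_diff_left)
  qed
  then show ?thesis
    by (simp add: defect_def algebra_simps)
qed

text \<open>Metric compatibility, with the derivative of \<open>\<langle>Y, g Z\<rangle>\<close> expanded by the product rule: the terms in
  \<open>D\<^sub>X Y\<close> and \<open>D\<^sub>X Z\<close> combine with the covariant derivatives into defects and only \<open>D\<^sub>X g\<close> remains.\<close>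

lemma defect_metric:
  assumes X: "vector_field M X" and Y: "vector_field M Y" and Z: "vector_field M Z" and x: "x \<in> M"
  shows "defect X Y x \<bullet> g x (Z x) + defect X Z x \<bullet> g x (Y x) = dir_deriv M g x (X x) (Z x) \<bullet> Y x"
proof -
  have sm: "smooth_map M Y" "smooth_map M Z"
    and tan: "\<And>y. y \<in> M \<Longrightarrow> X y \<in> T y" "\<And>y. y \<in> M \<Longrightarrow> Y y \<in> T y" "\<And>y. y \<in> M \<Longrightarrow> Z y \<in> T y"
      "\<And>y. y \<in> M \<Longrightarrow> nabla X Y y \<in> T y" "\<And>y. y \<in> M \<Longrightarrow> nabla X Z y \<in> T y"
    using X Y Z vector_field_nabla[OF X Y] vector_field_nabla[OF X Z]
    by (auto simp: vector_field_def)
  have smgZ: "smooth_map M (\<lambda>y. g y (Z y))"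
    using smooth_metric sm(2) by (rule smooth_map_bilinear[OF bounded_bilinear_blinfun_apply])
  have "dir_deriv M (\<lambda>y. \<rho> y (Y y) (Z y)) x (X x) = dir_deriv M (\<lambda>y. Y y \<bullet> g y (Z y)) x (X x)"
    by (rule dir_deriv_cong[OF smooth_map_bilinear[OF bounded_bilinear_inner sm(1) smgZ] _ tan(1)[OF x]])
      (simp add: metric_\<rho> tan)
  also have "\<dots> = Y x \<bullet> (g x (dir_deriv M Z x (X x)) + dir_deriv M g x (X x) (Z x)) +
      dir_deriv M Y x (X x) \<bullet> g x (Z x)"
    using tan(1)[OF x] x
    by (simp add: dir_deriv_bilinear[OF bounded_bilinear_inner sm(1) smgZ]
        dir_deriv_bilinear[OF bounded_bilinear_blinfun_apply smooth_metric sm(2)])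
  finally have "nabla X Y x \<bullet> g x (Z x) + Y x \<bullet> g x (nabla X Z x) = \<dots>"
    using levi_civita X Y Z x tan by (simp add: levi_civita_def metric_compatible_def metric_\<rho>)
  moreover note metric_swap[OF x, of "Y x" "nabla X Z x"]
    metric_swap[OF x, of "Y x" "dir_deriv M Z x (X x)"]
    inner_commute[of "Y x" "dir_deriv M g x (X x) (Z x)"]
  ultimately show ?thesis
    by (simp add: defect_def inner_diff_left inner_add_right)
qed

text \<open>The Koszul argument: cyclic permutation of metric compatibility, with the symmetry of the defect
  cancelling the unwanted terms.\<close>

lemma defect_tangential:
  assumes "vector_field M X" "vector_field M Y" "x \<in> M" "\<phi> \<in> T x"
  shows "2 * (defect X Y x \<bullet> g x \<phi>) = dir_deriv M g x (X x) (Y x) \<bullet> \<phi> +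
    dir_deriv M g x (Y x) (X x) \<bullet> \<phi> - dir_deriv M g x \<phi> (X x) \<bullet> Y x"
proof -
  let ?Z = "\<lambda>y. proj y \<phi>"
  note Z = vector_field_proj[of \<phi>]
  have "?Z x = \<phi>"
    using assms by (simp add: proj_g_fixes_tangent)
  with defect_metric[OF assms(1) Z assms(2,3)] defect_metric[OF assms(2) Z assms(1,3)]
    defect_metric[OF Z assms(2,1,3)] defect_symmetric[OF assms(1,2,3)] defect_symmetric[OF assms(1) Z assms(3)]
    defect_symmetric[OF assms(2) Z assms(3)]
  show ?thesis
    by simp
qed

text \<open>Differentiating \<open>\<Pi> Y = Y\<close> gives \<open>(1 - \<Pi>) D\<^sub>X Y = (D\<^sub>X \<Pi>) Y\<close>, while \<open>\<nabla>\<^sub>X Y\<close> is tangent.\<close>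

lemma defect_normal:
  assumes X: "vector_field M X" and Y: "vector_field M Y" and x: "x \<in> M"
  shows "defect X Y x - proj x (defect X Y x) = - dir_deriv M proj x (X x) (Y x)"
proof -
  have smY: "smooth_map M Y" and YT: "\<And>y. y \<in> M \<Longrightarrow> Y y \<in> T y" and XT: "X x \<in> T x"
    and nT: "nabla X Y x \<in> T x"
    using X Y x vector_field_nabla[OF X Y] by (auto simp: vector_field_def)
  have "dir_deriv M Y x (X x) = dir_deriv M (\<lambda>y. proj y (Y y)) x (X x)"
    by (rule dir_deriv_cong[symmetric, OF smY _ XT]) (simp add: proj_g_fixes_tangent YT)
  also have "\<dots> = proj x (dir_deriv M Y x (X x)) + dir_deriv M proj x (X x) (Y x)"
    by (rule dir_deriv_bilinear[OF bounded_bilinear_blinfun_apply smooth_proj_g smY XT])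
  finally show ?thesis
    using proj_g_fixes_tangent[OF x nT] by (simp add: defect_def blinfun.diff_right algebra_simps)
qed

text \<open>Any \<open>w\<close> representing \<open>\<phi> \<mapsto> \<langle>(D\<^sub>\<phi> g) X, Y\<rangle>\<close> on the tangent space will do, because \<open>\<Pi> g\<inverse> w\<close> is
  determined by the inner products of \<open>w\<close> with tangent vectors.\<close>

lemma defect_formula:
  assumes "vector_field M X" "vector_field M Y" and x: "x \<in> M"
    and w: "\<And>\<phi>. \<phi> \<in> T x \<Longrightarrow> w \<bullet> \<phi> = dir_deriv M g x \<phi> (X x) \<bullet> Y x"
  shows "defect X Y x = - dir_deriv M proj x (X x) (Y x) + (1/2) *\<^sub>R proj x (inv (blinfun_apply (g x))
    (dir_deriv M g x (X x) (Y x) + dir_deriv M g x (Y x) (X x) - w))"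
proof -
  let ?w = "dir_deriv M g x (X x) (Y x) + dir_deriv M g x (Y x) (X x) - w"
  let ?t = "(1/2) *\<^sub>R proj x (inv (blinfun_apply (g x)) ?w)"
  have "proj x (defect X Y x) - ?t = 0"
  proof (rule tangent_orthogonal_zero[OF x])
    show "proj x (defect X Y x) - ?t \<in> T x"
      using subspace_T[OF x] by (intro subspace_diff subspace_scale proj_g_tangent x)
    show "(proj x (defect X Y x) - ?t) \<bullet> g x \<phi> = 0" if "\<phi> \<in> T x" for \<phi>
      using defect_tangential[OF assms(1-3) that] w[OF that]
      by (simp add: inner_diff_left inner_add_left proj_g_inner[OF x that]
          inner_metric_inverse[OF x])
  qed
  then show ?thesis
    using defect_normal[OF assms(1-3)] by (simp add: algebra_simps)
qed

end

section \<open>Christoffel functions\<close>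

context ambient_levi_civita
begin

text \<open>On the tangent space, the derivatives of \<open>g\<close> and \<open>\<Pi>\<close> at \<open>x\<close> are linear in the direction; with
  linear extensions to the ambient space in their place, the formula for the defect is bilinear.\<close>

lemma defect_bilinear:
  assumes x: "x \<in> M"
  obtains B where "bilinear B"
    "\<And>X Y. vector_field M X \<Longrightarrow> vector_field M Y \<Longrightarrow> defect X Y x = B (X x) (Y x)"
proof -
  obtain Dg where Dg: "linear Dg" "\<And>v. v \<in> T x \<Longrightarrow> dir_deriv M g x v = Dg v"
    using smooth_metric x by (rule dir_deriv_linear_in_direction) blast
  obtain Dp where Dp: "linear Dp" "\<And>v. v \<in> T x \<Longrightarrow> dir_deriv M proj x v = Dp v"
    using smooth_proj_g x by (rule dir_deriv_linear_in_direction) blast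
  \<comment> \<open>a vector representing the linear form \<open>\<phi> \<mapsto> \<langle>(D\<^sub>\<phi> g) \<xi>, \<eta>\<rangle>\<close>\<close>
  define W where "W \<xi> \<eta> = (\<Sum>b\<in>Basis. (Dg b \<xi> \<bullet> \<eta>) *\<^sub>R b)" for \<xi> \<eta>
  have W: "W \<xi> \<eta> \<bullet> \<phi> = Dg \<phi> \<xi> \<bullet> \<eta>" for \<xi> \<eta> \<phi>
  proof -
    have "linear (\<lambda>\<phi>. Dg \<phi> \<xi> \<bullet> \<eta>)"
      by (rule linearI) (simp_all add: linear_add[OF Dg(1)] linear_scale[OF Dg(1)]
          blinfun.add_left blinfun.scaleR_left inner_add_left)
    from basis_blinfun_linear[OF this, of \<phi>] show ?thesis
      by (simp add: W_def basis_blinfun_apply inner_sum_left inner_commute[of \<phi>] mult.commute)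
  qed
  define G where "G = blinfun_inv (g x)"
  have "blinfun_apply G = inv (blinfun_apply (g x))"
    unfolding G_def by (rule blinfun_inv_apply[OF metric_inj[OF x]])
  note G = this[symmetric]
  define B where "B \<xi> \<eta> = - Dp \<xi> \<eta> + (1/2) *\<^sub>R proj x (G (Dg \<xi> \<eta> + Dg \<eta> \<xi> - W \<xi> \<eta>))" for \<xi> \<eta>
  note lin = linear_add[OF Dg(1)] linear_scale[OF Dg(1)] linear_add[OF Dp(1)] linear_scale[OF Dp(1)]
    blinfun.add_left blinfun.add_right blinfun.diff_right blinfun.scaleR_left blinfun.scaleR_right
    inner_add_left inner_add_right
  have W_bilinear: "W (\<xi> + \<xi>') \<eta> = W \<xi> \<eta> + W \<xi>' \<eta>" "W (c *\<^sub>R \<xi>) \<eta> = c *\<^sub>R W \<xi> \<eta>"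
    "W \<xi> (\<eta> + \<eta>') = W \<xi> \<eta> + W \<xi> \<eta>'" "W \<xi> (c *\<^sub>R \<eta>) = c *\<^sub>R W \<xi> \<eta>" for \<xi> \<xi>' \<eta> \<eta>' c
    by (simp_all add: W_def lin scaleR_add_left sum.distrib scaleR_sum_right)
  have "bilinear B"
    unfolding bilinear_def B_def
    by (intro conjI allI linearI) (simp_all add: lin W_bilinear algebra_simps)
  moreover have "defect X Y x = B (X x) (Y x)" if "vector_field M X" "vector_field M Y" for X Y
  proof -
    have "X x \<in> T x" "Y x \<in> T x"
      using that x by (auto simp: vector_field_def)
    then show ?thesis
      using defect_formula[OF that x, of "W (X x) (Y x)"] by (simp add: B_def G Dg Dp W)
  qed
  ultimately show ?thesis
    by (rule that)
qed

text \<open>The projected basis fields provide the coefficients: the defect is smooth along global vector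
  fields, and bilinearity recovers it from its values there.\<close>

lemma christoffel_function_exists: "\<exists>\<Gamma>. christoffel_function M nabla \<Gamma>"
proof -
  let ?E = "\<lambda>w y. proj y w"
  define \<Gamma> where "\<Gamma> x = basis_blinfun (\<lambda>b. basis_blinfun (\<lambda>c. defect (?E b) (?E c) x))" for x
  have "smooth_map M (\<lambda>x. defect (?E b) (?E c) x)" for b c
  proof -
    have "smooth_map M (nabla (?E b) (?E c))" "smooth_map M (?E c)"
      using vector_field_nabla[OF vector_field_proj vector_field_proj] vector_field_proj
      by (auto simp: vector_field_def)
    then show ?thesis
      unfolding defect_def by (intro smooth_map_diff smooth_map_dir_deriv vector_field_proj)
  qed
  then have "smooth_map M \<Gamma>"
    unfolding \<Gamma>_def by (intro smooth_map_basis_blinfun)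
  moreover have "nabla X Y x = dir_deriv M Y x (X x) + \<Gamma> x (X x) (Y x)"
    if "vector_field M X" "vector_field M Y" and x: "x \<in> M" for X Y x
  proof -
    obtain B where B: "bilinear B"
      "\<And>X Y. vector_field M X \<Longrightarrow> vector_field M Y \<Longrightarrow> defect X Y x = B (X x) (Y x)"
      using x by (rule defect_bilinear) blast
    have lin: "linear (\<lambda>c. B u (proj x c))" "linear (\<lambda>b. B (proj x b) v)" for u v
      using B(1) linear_compose[OF blinfun_linear[of "proj x"], of "B u"]
        linear_compose[OF blinfun_linear[of "proj x"], of "\<lambda>w. B w v"]
      by (auto simp: bilinear_def o_def)
    have "\<Gamma> x u v = B (proj x u) (proj x v)" for u v
    proof -
      have "\<Gamma> x u v = (\<Sum>b\<in>Basis. (u \<bullet> b) *\<^sub>R basis_blinfun (\<lambda>c. B (proj x b) (proj x c)) v)"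
        by (simp add: \<Gamma>_def B(2) vector_field_proj basis_blinfun_apply[of _ u] blinfun.sum_left
            blinfun.scaleR_left)
      also have "\<dots> = basis_blinfun (\<lambda>b. B (proj x b) (proj x v)) u"
        by (simp add: basis_blinfun_linear lin basis_blinfun_apply[of _ u])
      finally show ?thesis
        by (simp add: basis_blinfun_linear lin)
    qed
    moreover have "X x \<in> T x" "Y x \<in> T x"
      using that by (auto simp: vector_field_def)
    ultimately have "\<Gamma> x (X x) (Y x) = defect X Y x"
      using B(2)[OF that(1,2)] by (simp add: proj_g_fixes_tangent x)
    then show ?thesis
      by (simp add: defect_def)
  qed
  ultimately show ?thesis
    unfolding christoffel_function_def by blast
qed

lemma christoffel_function_defect:
  assumes "christoffel_function M nabla \<Gamma>" "vector_field M X" "vector_field M Y" "x \<in> M"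
  shows "\<Gamma> x (X x) (Y x) = defect X Y x"
  using assms by (simp add: christoffel_function_def defect_def)

lemma christoffel_function_proj:
  assumes "christoffel_function M nabla \<Gamma>" "x \<in> M" "\<xi> \<in> T x" "\<eta> \<in> T x"
  shows "\<Gamma> x \<xi> \<eta> = defect (\<lambda>y. proj y \<xi>) (\<lambda>y. proj y \<eta>) x"
  using christoffel_function_defect[OF assms(1) vector_field_proj vector_field_proj assms(2), of \<xi> \<eta>]
  by (simp add: proj_g_fixes_tangent assms)

end

text \<open>The tangential part of the derivative of a metric operator only sees the operator on tangent
  vectors: in the product rule for \<open>g Z\<close> the term \<open>\<langle>g (D\<^sub>v Z), \<eta>\<rangle> = \<langle>D\<^sub>v Z, g \<eta>\<rangle>\<close> is determined
  by self-adjointness.\<close>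

lemma dir_deriv_metric_eq_on_tangent:
  assumes "ambient d M \<rho> g" "ambient d M \<rho>' g'"
    and eq: "\<And>y v. y \<in> M \<Longrightarrow> v \<in> tangent_space M y \<Longrightarrow> g' y v = g y v"
    and x: "x \<in> M" and v: "v \<in> tangent_space M x"
    and \<xi>: "\<xi> \<in> tangent_space M x" and \<eta>: "\<eta> \<in> tangent_space M x"
  shows "dir_deriv M g' x v \<xi> \<bullet> \<eta> = dir_deriv M g x v \<xi> \<bullet> \<eta>"
proof -
  interpret a: ambient d M \<rho> g by fact
  interpret a': ambient d M \<rho>' g' by fact
  let ?Z = "\<lambda>y. proj_g M g y \<xi>"
  have Z: "smooth_map M ?Z" "\<And>y. y \<in> M \<Longrightarrow> ?Z y \<in> tangent_space M y"
    using a.vector_field_proj[of \<xi>] by (auto simp: vector_field_def)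
  have Zx: "?Z x = \<xi>"
    by (rule a.proj_g_fixes_tangent[OF x \<xi>])
  let ?w = "dir_deriv M ?Z x v"
  note bil = bounded_bilinear_blinfun_apply
  have "g' x ?w + dir_deriv M g' x v \<xi> = dir_deriv M (\<lambda>y. g' y (?Z y)) x v"
    using dir_deriv_bilinear[OF bil a'.smooth_metric Z(1) v] by (simp only: Zx)
  also have "\<dots> = dir_deriv M (\<lambda>y. g y (?Z y)) x v"
    by (rule dir_deriv_cong[OF smooth_map_bilinear[OF bil a.smooth_metric Z(1)] _ v])
      (rule eq[OF _ Z(2)])
  also have "\<dots> = g x ?w + dir_deriv M g x v \<xi>"
    using dir_deriv_bilinear[OF bil a.smooth_metric Z(1) v] by (simp only: Zx)
  finally have "g' x ?w \<bullet> \<eta> + dir_deriv M g' x v \<xi> \<bullet> \<eta> = g x ?w \<bullet> \<eta> + dir_deriv M g x v \<xi> \<bullet> \<eta>"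
    by (metis inner_add_left)
  moreover have "g' x ?w \<bullet> \<eta> = g x ?w \<bullet> \<eta>"
    by (simp add: a.metric_sym[OF x] a'.metric_sym[OF x] eq[OF x \<eta>])
  ultimately show ?thesis
    by simp
qed

text \<open>The defects of two connections along the same fields differ by a tangent vector, since the
  directional derivatives cancel; the Koszul formula shows that it is orthogonal to the tangent space.\<close>

lemma christoffel_function_unique_on_tangent:
  assumes lc: "ambient_levi_civita d M \<rho> g nabla" and lc': "ambient_levi_civita d M \<rho>' g' nabla'"
    and eq: "\<And>y v. y \<in> M \<Longrightarrow> v \<in> tangent_space M y \<Longrightarrow> g' y v = g y v"
    and \<Gamma>: "christoffel_function M nabla \<Gamma>" and \<Gamma>': "christoffel_function M nabla' \<Gamma>'"
    and x: "x \<in> M" and \<xi>: "\<xi> \<in> tangent_space M x" and \<eta>: "\<eta> \<in> tangent_space M x"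
  shows "\<Gamma>' x \<xi> \<eta> = \<Gamma> x \<xi> \<eta>"
proof -
  interpret a: ambient_levi_civita d M \<rho> g nabla by fact
  interpret a': ambient_levi_civita d M \<rho>' g' nabla' by fact
  let ?X = "\<lambda>y. proj_g M g y \<xi>" and ?Y = "\<lambda>y. proj_g M g y \<eta>"
  note XY = a.vector_field_proj[of \<xi>] a.vector_field_proj[of \<eta>]
  have at_x: "?X x = \<xi>" "?Y x = \<eta>"
    using a.proj_g_fixes_tangent x \<xi> \<eta> by auto
  have defects: "\<Gamma>' x \<xi> \<eta> = a'.defect ?X ?Y x" "\<Gamma> x \<xi> \<eta> = a.defect ?X ?Y x"
    using a'.christoffel_function_defect[OF \<Gamma>' XY x] a.christoffel_function_defect[OF \<Gamma> XY x]
    by (simp_all add: at_x)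
  have "a'.defect ?X ?Y x - a.defect ?X ?Y x = 0"
  proof (rule a.tangent_orthogonal_zero[OF x])
    have "nabla' ?X ?Y x \<in> a.T x" "nabla ?X ?Y x \<in> a.T x"
      using a'.vector_field_nabla[OF XY] a.vector_field_nabla[OF XY] x by (auto simp: vector_field_def)
    then show "a'.defect ?X ?Y x - a.defect ?X ?Y x \<in> a.T x"
      using a.subspace_T[OF x] by (simp add: a.defect_def a'.defect_def subspace_diff)
    show "(a'.defect ?X ?Y x - a.defect ?X ?Y x) \<bullet> g x \<phi> = 0" if \<phi>: "\<phi> \<in> a.T x" for \<phi>
      using a.defect_tangential[OF XY x \<phi>] a'.defect_tangential[OF XY x \<phi>]
        dir_deriv_metric_eq_on_tangent[OF a.ambient_axioms a'.ambient_axioms eq x] \<phi> \<xi> \<eta>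
      by (simp add: at_x eq[OF x \<phi>] inner_diff_left)
  qed
  then show ?thesis
    by (simp add: defects)
qed

theorem proposition2:
  fixes M :: "'a::euclidean_space set"
    and d :: nat
    and \<rho> :: "'a \<Rightarrow> 'a \<Rightarrow> 'a \<Rightarrow> real"
    and g :: "'a \<Rightarrow> 'a \<Rightarrow>\<^sub>L 'a"
  assumes amb: "ambient_structure d M \<rho> g"
  shows
    "smooth_map M (proj_g M g) \<and>
     (\<forall>nabla. levi_civita M \<rho> nabla \<longrightarrow>
        (\<exists>\<Gamma>. christoffel_function M nabla \<Gamma>) \<and>
        (\<forall>\<Gamma>. christoffel_function M nabla \<Gamma> \<longrightarrow>
           \<comment> \<open>independence of the extensions\<close>
           (\<forall>x\<in>M. \<forall>\<xi>\<in>tangent_space M x. \<forall>\<eta>\<in>tangent_space M x.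
              (\<exists>X Y. vector_field M X \<and> vector_field M Y \<and> X x = \<xi> \<and> Y x = \<eta>) \<and>
              (\<forall>X Y. vector_field M X \<and> vector_field M Y \<and> X x = \<xi> \<and> Y x = \<eta> \<longrightarrow>
                 nabla X Y x - dir_deriv M Y x (X x) = blinfun_apply (blinfun_apply (\<Gamma> x) \<xi>) \<eta>)) \<and>
           \<comment> \<open>dependence on the restriction of the metric operator to the tangent bundle only\<close>
           (\<forall>\<rho>' g' nabla' \<Gamma>'.
              ambient_structure d M \<rho>' g' \<and> levi_civita M \<rho>' nabla' \<and>
              christoffel_function M nabla' \<Gamma>' \<and>
              (\<forall>y\<in>M. \<forall>v\<in>tangent_space M y. g' y v = g y v) \<longrightarrow>
              (\<forall>x\<in>M. \<forall>\<xi>\<in>tangent_space M x. \<forall>\<eta>\<in>tangent_space M x.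
                 blinfun_apply (blinfun_apply (\<Gamma>' x) \<xi>) \<eta> = blinfun_apply (blinfun_apply (\<Gamma> x) \<xi>) \<eta>)) \<and>
           \<comment> \<open>the formula for the Christoffel function\<close>
           (\<forall>\<X> :: 'a \<Rightarrow> 'a \<Rightarrow>\<^sub>L 'a \<Rightarrow>\<^sub>L 'a.
              smooth_map M \<X> \<and>
              (\<forall>x\<in>M. \<forall>\<xi>\<in>tangent_space M x. \<forall>\<eta>\<in>tangent_space M x. \<forall>\<phi>\<in>tangent_space M x.
                 blinfun_apply (blinfun_apply (\<X> x) \<xi>) \<eta> \<bullet> \<phi> =
                 blinfun_apply (dir_deriv M g x \<phi>) \<xi> \<bullet> \<eta>) \<longrightarrow>
              (\<forall>x\<in>M. \<forall>\<xi>\<in>tangent_space M x. \<forall>\<eta>\<in>tangent_space M x.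
                 blinfun_apply (blinfun_apply (\<Gamma> x) \<xi>) \<eta> =
                   - blinfun_apply (dir_deriv M (proj_g M g) x \<xi>) \<eta> +
                   (1/2) *\<^sub>R blinfun_apply (proj_g M g x)
                     (inv (blinfun_apply (g x))
                       (blinfun_apply (dir_deriv M g x \<xi>) \<eta> + blinfun_apply (dir_deriv M g x \<eta>) \<xi> -
                        blinfun_apply (blinfun_apply (\<X> x) \<xi>) \<eta>))))))"
proof -
  interpret ambient d M \<rho> g
    by (rule ambient.intro[OF amb])
  have lc: "ambient_levi_civita d M \<rho>' g' nabla"
    if "ambient_structure d M \<rho>' g'" "levi_civita M \<rho>' nabla" for \<rho>' g' nabla
    using that by (intro ambient_levi_civita.intro ambient.intro ambient_levi_civita_axioms.intro)
  show ?thesis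
  proof (rule conjI[OF smooth_proj_g], intro allI impI conjI ballI)
    fix nabla
    assume nabla: "levi_civita M \<rho> nabla"
    interpret ambient_levi_civita d M \<rho> g nabla
      by (rule lc[OF amb nabla])
    show "\<exists>\<Gamma>. christoffel_function M nabla \<Gamma>"
      by (rule christoffel_function_exists)
    fix \<Gamma> x \<xi> \<eta>
    assume \<Gamma>: "christoffel_function M nabla \<Gamma>" and x: "x \<in> M" and \<xi>: "\<xi> \<in> T x" and \<eta>: "\<eta> \<in> T x"
    show "\<exists>X Y. vector_field M X \<and> vector_field M Y \<and> X x = \<xi> \<and> Y x = \<eta>"
      using vector_field_proj proj_g_fixes_tangent[OF x \<xi>] proj_g_fixes_tangent[OF x \<eta>] by blast
    show "nabla X Y x - dir_deriv M Y x (X x) = \<Gamma> x \<xi> \<eta>"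
      if "vector_field M X \<and> vector_field M Y \<and> X x = \<xi> \<and> Y x = \<eta>" for X Y
      using that christoffel_function_defect[OF \<Gamma> _ _ x, of X Y] by (simp add: defect_def)
    show "\<Gamma>' x \<xi> \<eta> = \<Gamma> x \<xi> \<eta>"
      if "ambient_structure d M \<rho>' g' \<and> levi_civita M \<rho>' nabla' \<and>
        christoffel_function M nabla' \<Gamma>' \<and> (\<forall>y\<in>M. \<forall>v\<in>T y. g' y v = g y v)" for \<rho>' g' nabla' \<Gamma>'
      using that
      by (intro christoffel_function_unique_on_tangent[OF lc[OF amb nabla] lc _ \<Gamma> _ x \<xi> \<eta>,
            of \<rho>' g' nabla']) auto
    show "\<Gamma> x \<xi> \<eta> = - dir_deriv M proj x \<xi> \<eta> + (1/2) *\<^sub>R proj x (inv (blinfun_apply (g x))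
        (dir_deriv M g x \<xi> \<eta> + dir_deriv M g x \<eta> \<xi> - \<X> x \<xi> \<eta>))"
      if "smooth_map M \<X> \<and> (\<forall>x\<in>M. \<forall>\<xi>\<in>T x. \<forall>\<eta>\<in>T x. \<forall>\<phi>\<in>T x.
        \<X> x \<xi> \<eta> \<bullet> \<phi> = dir_deriv M g x \<phi> \<xi> \<bullet> \<eta>)" for \<X> :: "'a \<Rightarrow> 'a \<Rightarrow>\<^sub>L 'a \<Rightarrow>\<^sub>L 'a"
      using defect_formula[OF vector_field_proj vector_field_proj x, of "\<X> x \<xi> \<eta>" \<xi> \<eta>]
        christoffel_function_proj[OF \<Gamma> x \<xi> \<eta>] proj_g_fixes_tangent[OF x \<xi>]
        proj_g_fixes_tangent[OF x \<eta>] that x \<xi> \<eta>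
      by simp
  qed
qed

end
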